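(* With respect to $\mathbb{P}^{\mathrm{ch}}$, the process $(M_t)_{t\ge0}$ is a bounded martingale; hence it converges $\mathbb{P}^{\mathrm{ch}}$-almost surely and in $L^1$ to a random variable $M_\infty$. Moreover, for every $\rho\in\mathcal{D}_k$, \[\mathrm{d}\mathbb{P}^\rho=k\operatorname{tr}(\rho M_\infty)\,\mathrm{d}\mathbb{P}^{\mathrm{ch}},\] and $(M_t)$ converges to $M_\infty$ $\mathbb{P}^\rho$-almost surely and in $L^1(\mathbb{P}^\rho)$.
   Context: Let $k\ge1$, $H\in M_k(\mathbb{C})$ self-adjoint, $I_b,I_p$ finite disjoint index sets, $L_i\in M_k(\mathbb{C})$ ($i\in I_b$), $C_j\in M_k(\mathbb{C})$ ($j\in I_p$), and $\mathcal{D}_k=\{\rho\in M_k(\mathbb{C}):\rho\ge0,\operatorname{tr}\rho=1\}$. Let $(\Omega,(\mathcal{F}_t)_{t\ge0},\mathbb{P})$ be a filtered probability space satisfying the usual conditions, carrying independent standard Brownian motions $W_i$ ($i\in I_b$) and standard rate-one Poisson processes $N_j$ ($j\in I_p$) such that $W_i(t)$ and $N_j(t)-t$ are $(\mathcal{F}_t)$-martingales; $\mathcal{F}=\mathcal{F}_\infty$. Let $K=-\mathrm{i}H-\frac12(\sum_{i}L_i^*L_i+\sum_{j}C_j^*C_j)$ and $(S_t)$ the solution of $\mathrm{d}S_t=(K+\tfrac{\#I_p}{2}\mathrm{Id})S_{t-}\,\mathrm{d}t+\sum_{i\in I_b}L_iS_{t-}\,\mathrm{d}W_i(t)+\sum_{j\in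 I_p}(C_j-\mathrm{Id})S_{t-}\,\mathrm{d}N_j(t)$, $S_0=\mathrm{Id}$. For $\rho\in\mathcal{D}_k$, $Z^\rho_t=\operatorname{tr}(S_t^*S_t\rho)$ is a nonnegative $\mathbb{P}$-martingale and $\mathbb{P}^\rho$ is the unique probability on $(\Omega,\mathcal{F})$ with $\mathrm{d}\mathbb{P}^\rho|_{\mathcal{F}_t}=Z^\rho_t\,\mathrm{d}\mathbb{P}|_{\mathcal{F}_t}$ for all $t$. Write $\mathbb{P}^{\mathrm{ch}}=\mathbb{P}^{\mathrm{Id}/k}$. Define $M_t=S_t^*S_t/\operatorname{tr}(S_t^*S_t)$ when $\operatorname{tr}(S_t^*S_t)\ne0$, and $M_t$ equal to a fixed arbitrary matrix otherwise. *)

theory Defs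
  imports "HOL-Probability.Probability" "HOL-Analysis.Analysis"
begin

type_synonym 'k cmat = "complex^'k^'k"

definition adj :: "'k::finite cmat \<Rightarrow> 'k cmat" where
  "adj A = (\<chi> i j. cnj (A $ j $ i))"

definition mtrace :: "'k::finite cmat \<Rightarrow> complex" where
  "mtrace A = (\<Sum>i\<in>UNIV. A $ i $ i)"

definition cscale :: "complex \<Rightarrow> 'k::finite cmat \<Rightarrow> 'k cmat" where
  "cscale c A = (\<chi> i j. c * A $ i $ j)"

definition psd :: "'k::finite cmat \<Rightarrow> bool" where
  "psd A \<longleftrightarrow> (\<forall>v::complex^'k.
     (\<Sum>i\<in>UNIV. \<Sum>j\<in>UNIV. cnj (v $ i) * A $ i $ j * v $ j) \<in> \<real> \<and>
     Re (\<Sum>i\<in>UNIV. \<Sum>j\<in>UNIV. cnj (v $ i) * A $ i $ j * v $ j) \<ge> 0)"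

definition density_matrix :: "'k::finite cmat \<Rightarrow> bool" where
  "density_matrix \<rho> \<longleftrightarrow> psd \<rho> \<and> mtrace \<rho> = 1"

definition usual_filtration :: "'a measure \<Rightarrow> (real \<Rightarrow> 'a measure) \<Rightarrow> bool" where
  "usual_filtration P F \<longleftrightarrow>
     (\<forall>t\<ge>0. space (F t) = space P \<and> sets (F t) \<subseteq> sets P) \<and>
     (\<forall>s t. 0 \<le> s \<longrightarrow> s \<le> t \<longrightarrow> sets (F s) \<subseteq> sets (F t)) \<and>
     (\<forall>A B. A \<in> null_sets P \<longrightarrow> B \<subseteq> A \<longrightarrow> B \<in> sets P) \<and>
     (\<forall>t\<ge>0. null_sets P \<subseteq> sets (F t)) \<and>
     (\<forall>t\<ge>0. sets (F t) = (\<Inter>s\<in>{t<..}. sets (F s))) \<and>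
     sets P = sigma_sets (space P) (\<Union>t\<in>{0..}. sets (F t))"

definition cmartingale :: "'a measure \<Rightarrow> (real \<Rightarrow> 'a measure) \<Rightarrow>
     (real \<Rightarrow> 'a \<Rightarrow> 'b::{banach,second_countable_topology}) \<Rightarrow> bool" where
  "cmartingale Q F X \<longleftrightarrow>
     (\<forall>t\<ge>0. X t \<in> borel_measurable (F t) \<and> integrable Q (X t)) \<and>
     (\<forall>s t A. 0 \<le> s \<longrightarrow> s \<le> t \<longrightarrow> A \<in> sets (F s) \<longrightarrow>
        set_lebesgue_integral Q A (X t) = set_lebesgue_integral Q A (X s))"

definition Mproc :: "(real \<Rightarrow> 'a \<Rightarrow> 'k::finite cmat) \<Rightarrow> 'k cmat \<Rightarrow> real \<Rightarrow> 'a \<Rightarrow> 'k cmat" where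
  "Mproc S M0 t \<omega> =
     (if mtrace (adj (S t \<omega>) ** S t \<omega>) \<noteq> 0
      then cscale (1 / mtrace (adj (S t \<omega>) ** S t \<omega>)) (adj (S t \<omega>) ** S t \<omega>)
      else M0)"

end

theory Submission
  imports Defs
begin

text \<open>
  Let \<open>Q\<close> be the measure belonging to the chaotic state. On \<open>F t\<close> the density of \<open>Prho \<rho>\<close> with respect
  to \<open>Q\<close> is \<open>k tr(\<rho> M t)\<close>, so \<open>k \<integral>\<^sub>A tr(\<rho> M t) dQ = Prho \<rho> A\<close> for \<open>A \<in> F t\<close>, which does not depend
  on \<open>t\<close>. Density matrices separate matrices, hence \<open>M\<close> is a (bounded) \<open>Q\<close>-martingale. It is
  right-continuous off a \<open>Q\<close>-null set because the density process of \<open>Q\<close> almost surely never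
  vanishes. A bounded martingale is Cauchy in \<open>L\<^sup>2\<close>, and the maximal inequality along rational times
  turns this into almost sure convergence. Letting \<open>t \<rightarrow> \<infinity>\<close> in the displayed identity gives the density
  formula on \<open>\<Union>t. F t\<close>, and a \<open>\<pi>\<close>-\<open>\<lambda>\<close> argument extends it to the whole sigma-algebra; in particular
  \<open>Prho \<rho>\<close> is absolutely continuous with respect to \<open>Q\<close>, so convergence carries over.
\<close>

section \<open>Bounded right-continuous martingales\<close>

text \<open>The base measure is called \<open>Q\<close> because the locale is interpreted with the
  chaotic measure; the reference measure \<open>P\<close> enters only through densities.\<close>

locale filtered_prob_space = prob_space Q for Q :: "'a measure" +
  fixes F :: "real \<Rightarrow> 'a measure"
  assumes subalgebra_F: "\<And>t. 0 \<le> t \<Longrightarrow> subalgebra Q (F t)"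
    and sets_F_mono: "\<And>s t. 0 \<le> s \<Longrightarrow> s \<le> t \<Longrightarrow> sets (F s) \<subseteq> sets (F t)"
begin

lemma space_F: "0 \<le> t \<Longrightarrow> space (F t) = space Q"
  using subalgebra_F by (simp add: subalgebra_def)

lemma sets_F: "0 \<le> t \<Longrightarrow> A \<in> sets (F t) \<Longrightarrow> A \<in> sets Q"
  using subalgebra_F by (auto simp: subalgebra_def)

lemma measurable_F: "0 \<le> t \<Longrightarrow> f \<in> measurable (F t) N \<Longrightarrow> f \<in> measurable Q N"
  using subalgebra_F measurable_from_subalg by blast

lemma measurable_F_mono:
  "0 \<le> s \<Longrightarrow> s \<le> t \<Longrightarrow> f \<in> measurable (F s) N \<Longrightarrow> f \<in> measurable (F t) N"
  using sets_F_mono[of s t] space_F[of s] space_F[of t] unfolding measurable_def by auto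

text \<open>Decompose the union according to the first time at which the path enters \<open>E\<close>.\<close>

lemma emeasure_finite_union_first_entrance:
  assumes "finite T" "T \<subseteq> {0..}"
    and E: "\<And>t. t \<in> T \<Longrightarrow> E t \<in> sets (F t)"
    and \<mu>: "sets \<mu> = sets Q"
    and le: "\<And>t A. t \<in> T \<Longrightarrow> A \<in> sets (F t) \<Longrightarrow> A \<subseteq> E t \<Longrightarrow> emeasure Q A \<le> emeasure \<mu> A"
  shows "emeasure Q (\<Union>t\<in>T. E t) \<le> emeasure \<mu> (\<Union>t\<in>T. E t)"
  using assms
\<comment> \<open>Times are added in increasing order. The union \<open>U\<close> over the earlier
  times then lies in \<open>sets (F b)\<close>, so the new piece \<open>E b - U\<close> is a set to
  which the comparison hypothesis at time \<open>b\<close> applies.\<close>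
proof (induction T rule: finite_linorder_max_induct)
  case empty
  then show ?case by simp
next
  case (insert b T)
  have b: "0 \<le> b" using insert by auto
  define U where "U = (\<Union>t\<in>T. E t)"
  have "E t \<in> sets (F b)" if "t \<in> T" for t
    using insert.prems insert.hyps that sets_F_mono[of t b] by (force simp: subset_iff)
  then have U: "U \<in> sets (F b)" unfolding U_def using insert.hyps by auto
  have Eb: "E b \<in> sets (F b)" using insert.prems by auto
  have IH: "emeasure Q U \<le> emeasure \<mu> U"
    unfolding U_def
  proof (rule insert.IH)
    show "emeasure Q A \<le> emeasure \<mu> A" if "t \<in> T" "A \<in> sets (F t)" "A \<subseteq> E t" for t A
      using insert.prems(4)[OF _ that(2,3)] that(1) by simp
  qed (use insert.prems in auto)
  have UQ: "U \<in> sets Q" "E b - U \<in> sets Q" "U \<in> sets \<mu>" "E b - U \<in> sets \<mu>"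
    using sets_F[OF b] U Eb \<mu> by auto
  have eq: "(\<Union>t\<in>insert b T. E t) = U \<union> (E b - U)" unfolding U_def by auto
  have "emeasure Q (U \<union> (E b - U)) = emeasure Q U + emeasure Q (E b - U)"
    by (rule plus_emeasure[symmetric]) (use UQ in auto)
  also have "\<dots> \<le> emeasure \<mu> U + emeasure \<mu> (E b - U)"
    using insert.prems(4)[of b "E b - U"] U Eb by (intro add_mono IH) auto
  also have "\<dots> = emeasure \<mu> (U \<union> (E b - U))"
    by (rule plus_emeasure) (use UQ in auto)
  finally show ?case unfolding eq .
qed

end

text \<open>Finite unions along an enumeration of \<open>T\<close> increase to the whole union, so
  continuity from below preserves the bound. This carries estimates from finite sets of times to all
  rational times.\<close>

lemma emeasure_countable_UN_le:
  assumes "countable T" and E: "\<And>t. t \<in> T \<Longrightarrow> E t \<in> sets M"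
    and le: "\<And>T'. finite T' \<Longrightarrow> T' \<subseteq> T \<Longrightarrow> emeasure M (\<Union>t\<in>T'. E t) \<le> c"
  shows "emeasure M (\<Union>t\<in>T. E t) \<le> c"
proof (cases "T = {}")
  case True
  then show ?thesis by simp
next
  case False
  define A where "A n = (\<Union>t\<in>from_nat_into T ` {..n}. E t)" for n
  have sub: "from_nat_into T ` {..n} \<subseteq> T" for n using from_nat_into[OF False] by auto
  have "T = (\<Union>n. from_nat_into T ` {..n})"
    unfolding image_UN[symmetric] UN_atMost_UNIV
    using range_from_nat_into[OF False \<open>countable T\<close>] by simp
  then have "(\<Union>t\<in>T. E t) = (\<Union>n. A n)" unfolding A_def by blast
  moreover have "emeasure M (\<Union>n. A n) = (SUP n. emeasure M (A n))"
  proof (rule SUP_emeasure_incseq[symmetric])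
    show "range A \<subseteq> sets M" unfolding A_def using sub E by (auto intro!: sets.finite_UN)
    show "incseq A" unfolding A_def incseq_def by force
  qed
  moreover have "\<dots> \<le> c" unfolding A_def using sub by (intro SUP_least le) auto
  ultimately show ?thesis by simp
qed

text \<open>The bridge between real and rational times: a strict inequality that a right-continuous
  path satisfies at \<open>t\<close> is still satisfied at some rational time after
  \<open>t\<close>.\<close>

lemma rational_right_of:
  assumes "eventually P (at_right (t::real))"
  shows "\<exists>q\<in>\<rat>. t < q \<and> P q"
proof -
  obtain b where "b > t" "\<And>y. t < y \<Longrightarrow> y < b \<Longrightarrow> P y"
    using assms unfolding eventually_at_right_field by blast
  then show ?thesis using Rats_dense_in_real[of t b] by auto
qed

text \<open>Bochner integrals commute with bounded linear maps. It serves to reduce matrix-valued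
  martingales to their real coordinates.\<close>

lemma cmartingale_bounded_linear:
  assumes T: "bounded_linear T" and X: "cmartingale Q F X"
    and sub: "\<And>t. 0 \<le> t \<Longrightarrow> subalgebra Q (F t)"
  shows "cmartingale Q F (\<lambda>t \<omega>. T (X t \<omega>))"
proof -
  interpret T: bounded_linear T by fact
  have int: "integrable Q (X t)" and meas: "X t \<in> borel_measurable (F t)" if "0 \<le> t" for t
    using X that unfolding cmartingale_def by blast+
  have comm: "set_lebesgue_integral Q A (\<lambda>\<omega>. T (X t \<omega>)) = T (set_lebesgue_integral Q A (X t))"
    if "A \<in> sets Q" "0 \<le> t" for A t
    unfolding set_lebesgue_integral_def T.scaleR[symmetric]
    by (intro integral_bounded_linear[OF T] integrable_mult_indicator that int)
  show ?thesis
    unfolding cmartingale_def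
  proof (intro conjI allI impI)
    fix t :: real assume t: "0 \<le> t"
    show "(\<lambda>\<omega>. T (X t \<omega>)) \<in> borel_measurable (F t)"
      by (rule borel_measurable_continuous_on[OF linear_continuous_on[OF T] meas[OF t]])
    show "integrable Q (\<lambda>\<omega>. T (X t \<omega>))" by (rule integrable_bounded_linear[OF T int[OF t]])
  next
    fix s t A assume st: "0 \<le> s" "s \<le> (t::real)" and A: "A \<in> sets (F s)"
    have "A \<in> sets Q" using sub[OF st(1)] A by (auto simp: subalgebra_def)
    moreover have "set_lebesgue_integral Q A (X t) = set_lebesgue_integral Q A (X s)"
      using X st A unfolding cmartingale_def by blast
    ultimately show "set_lebesgue_integral Q A (\<lambda>\<omega>. T (X t \<omega>)) = set_lebesgue_integral Q A (\<lambda>\<omega>. T (X s \<omega>))"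
      using st by (simp add: comm)
  qed
qed

section \<open>Square increments, a maximal inequality and almost sure convergence\<close>

context filtered_prob_space
begin

text \<open>\<open>X s\<close> is a version of the conditional expectation of \<open>X t\<close>
  given \<open>F s\<close>, and a bounded \<open>F s\<close>-measurable factor can be pulled out of
  that conditional expectation.\<close>

lemma martingale_orthogonal:
  fixes X :: "real \<Rightarrow> 'a \<Rightarrow> real"
  assumes X: "cmartingale Q F X" and st: "0 \<le> s" "s \<le> t"
    and bnd: "\<And>\<omega>. \<omega> \<in> space Q \<Longrightarrow> \<bar>X t \<omega>\<bar> \<le> B"
    and Y: "Y \<in> borel_measurable (F s)" "\<And>\<omega>. \<omega> \<in> space Q \<Longrightarrow> \<bar>Y \<omega>\<bar> \<le> C"
  shows "(\<integral>\<omega>. Y \<omega> * X t \<omega> \<partial>Q) = (\<integral>\<omega>. Y \<omega> * X s \<omega> \<partial>Q)"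
proof -
  interpret finite_measure_subalgebra Q "F s"
    by unfold_locales (rule subalgebra_F[OF st(1)])
  have int: "integrable Q (X t)" "integrable Q (X s)" and Xs: "X s \<in> borel_measurable (F s)"
    using X st unfolding cmartingale_def by auto
  have YQ: "Y \<in> borel_measurable Q" using measurable_F Y st by blast
  have ae: "AE \<omega> in Q. real_cond_exp Q (F s) (X t) \<omega> = X s \<omega>"
  proof (rule real_cond_exp_charact[OF _ int Xs])
    show "set_lebesgue_integral Q A (X t) = set_lebesgue_integral Q A (X s)" if "A \<in> sets (F s)" for A
      using X st that unfolding cmartingale_def by blast
  qed
  have "integrable Q (\<lambda>\<omega>. Y \<omega> * X t \<omega>)"
  proof (rule integrable_const_bound[where B="C * B"])
    show "AE x in Q. norm (Y x * X t x) \<le> C * B"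
      unfolding real_norm_def abs_mult
      by (rule AE_I2, rule mult_mono) (auto intro: Y bnd order_trans[OF abs_ge_zero Y(2)])
  qed (use YQ int in auto)
  then have "(\<integral>\<omega>. Y \<omega> * X t \<omega> \<partial>Q) = (\<integral>\<omega>. Y \<omega> * real_cond_exp Q (F s) (X t) \<omega> \<partial>Q)"
    by (intro real_cond_exp_intg(2)[symmetric] Y) (use int in auto)
  also have "\<dots> = (\<integral>\<omega>. Y \<omega> * X s \<omega> \<partial>Q)"
    by (rule integral_cong_AE) (use ae YQ int in auto)
  finally show ?thesis .
qed

text \<open>Pythagoras for martingales, localised to an event of \<open>F s\<close>: in the expanded
  square, the cross term has integral zero because the increment from \<open>s\<close> to
  \<open>t\<close> is orthogonal to bounded \<open>F s\<close>-measurable functions.\<close>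

lemma martingale_square_increment:
  fixes X :: "real \<Rightarrow> 'a \<Rightarrow> real"
  assumes X: "cmartingale Q F X" and st: "0 \<le> r" "r \<le> s" "s \<le> t"
    and bnd: "\<And>t \<omega>. 0 \<le> t \<Longrightarrow> \<omega> \<in> space Q \<Longrightarrow> \<bar>X t \<omega>\<bar> \<le> B"
    and A: "A \<in> sets (F s)"
  shows "(\<integral>\<omega>. indicator A \<omega> * (X t \<omega> - X r \<omega>)\<^sup>2 \<partial>Q) =
    (\<integral>\<omega>. indicator A \<omega> * (X s \<omega> - X r \<omega>)\<^sup>2 \<partial>Q) +
    (\<integral>\<omega>. indicator A \<omega> * (X t \<omega> - X s \<omega>)\<^sup>2 \<partial>Q)"
proof -
  have F_meas: "X u \<in> borel_measurable (F u)" if "0 \<le> u" for u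
    using X that by (auto simp: cmartingale_def)
  then have [measurable]: "X u \<in> borel_measurable Q" if "0 \<le> u" for u
    using that measurable_F by blast
  have AQ [measurable]: "A \<in> sets Q" using sets_F[of s A] A st by auto
  have XB: "\<bar>X u \<omega>\<bar> \<le> B" if "0 \<le> u" "\<omega> \<in> space Q" for u \<omega> using bnd that .
  have diff: "\<bar>X u \<omega> - X v \<omega>\<bar> \<le> 2 * B" if "0 \<le> u" "0 \<le> v" "\<omega> \<in> space Q" for u v \<omega>
    using XB[of u \<omega>] XB[of v \<omega>] that by linarith
  have int: "integrable Q (\<lambda>\<omega>. indicator A \<omega> * ((X u \<omega> - X v \<omega>) * (X u' \<omega> - X v' \<omega>)))"
    if "0 \<le> u" "0 \<le> v" "0 \<le> u'" "0 \<le> v'" for u v u' v'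
  proof (rule integrable_const_bound[where B="(2*B) * (2*B)"])
    show "AE \<omega> in Q. norm (indicator A \<omega> * ((X u \<omega> - X v \<omega>) * (X u' \<omega> - X v' \<omega>))) \<le> (2*B) * (2*B)"
    proof (rule AE_I2)
      fix \<omega> assume \<omega>: "\<omega> \<in> space Q"
      have "\<bar>X u \<omega> - X v \<omega>\<bar> * \<bar>X u' \<omega> - X v' \<omega>\<bar> \<le> (2*B) * (2*B)"
        using diff[OF that(1,2) \<omega>] diff[OF that(3,4) \<omega>] by (intro mult_mono) auto
      then show "norm (indicator A \<omega> * ((X u \<omega> - X v \<omega>) * (X u' \<omega> - X v' \<omega>))) \<le> (2*B) * (2*B)"
        by (auto simp: indicator_def abs_mult split: if_splits)
    qed
  qed (use that in measurable)
  \<comment> \<open>The indicator is absorbed into the test function; \<open>Y\<close> stays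
    \<open>F s\<close>-measurable because \<open>A\<close> belongs to \<open>F s\<close>, and it is
    bounded by \<open>2 * B\<close>.\<close>
  define Y where "Y \<omega> = indicator A \<omega> * (X s \<omega> - X r \<omega>)" for \<omega>
  have "X r \<in> borel_measurable (F s)" using measurable_F_mono[OF st(1,2)] F_meas[OF st(1)] .
  then have Y: "Y \<in> borel_measurable (F s)"
    unfolding Y_def using A F_meas[of s] st by (auto intro!: borel_measurable_times borel_measurable_diff)
  have "(\<integral>\<omega>. Y \<omega> * X t \<omega> \<partial>Q) = (\<integral>\<omega>. Y \<omega> * X s \<omega> \<partial>Q)"
  proof (rule martingale_orthogonal[OF X _ st(3) _ Y, of B "2*B"])
    show "\<bar>Y \<omega>\<bar> \<le> 2 * B" if "\<omega> \<in> space Q" for \<omega>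
      using diff[of s r \<omega>] st that unfolding Y_def by (auto simp: indicator_def)
  qed (use st bnd in auto)
  moreover have "integrable Q (\<lambda>\<omega>. Y \<omega> * X u \<omega>)" if "0 \<le> u" for u
  proof (rule integrable_const_bound[where B="(2*B) * B"])
    show "AE \<omega> in Q. norm (Y \<omega> * X u \<omega>) \<le> (2*B) * B"
    proof (rule AE_I2)
      fix \<omega> assume \<omega>: "\<omega> \<in> space Q"
      have "\<bar>Y \<omega>\<bar> \<le> 2 * B"
        using diff[of s r \<omega>] st \<omega> unfolding Y_def by (auto simp: indicator_def)
      then show "norm (Y \<omega> * X u \<omega>) \<le> (2*B) * B"
        using XB[OF that \<omega>] by (auto simp: abs_mult intro!: mult_mono)
    qed
    have "Y \<in> borel_measurable Q" by (rule measurable_F[OF _ Y]) (use st in simp)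
    then show "(\<lambda>\<omega>. Y \<omega> * X u \<omega>) \<in> borel_measurable Q" using that by simp
  qed
  ultimately have "(\<integral>\<omega>. Y \<omega> * X t \<omega> - Y \<omega> * X s \<omega> \<partial>Q) = 0"
    using st by (subst Bochner_Integration.integral_diff) auto
  then have orth: "(\<integral>\<omega>. indicator A \<omega> * ((X s \<omega> - X r \<omega>) * (X t \<omega> - X s \<omega>)) \<partial>Q) = 0"
    by (simp add: Y_def algebra_simps)
  have "(\<integral>\<omega>. indicator A \<omega> * (X t \<omega> - X r \<omega>)\<^sup>2 \<partial>Q) =
    (\<integral>\<omega>. (indicator A \<omega> * ((X s \<omega> - X r \<omega>) * (X s \<omega> - X r \<omega>)) +
      indicator A \<omega> * ((X t \<omega> - X s \<omega>) * (X t \<omega> - X s \<omega>))) +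
      2 * (indicator A \<omega> * ((X s \<omega> - X r \<omega>) * (X t \<omega> - X s \<omega>))) \<partial>Q)"
    by (rule Bochner_Integration.integral_cong) (auto simp: power2_eq_square algebra_simps)
  also have "\<dots> = (\<integral>\<omega>. indicator A \<omega> * ((X s \<omega> - X r \<omega>) * (X s \<omega> - X r \<omega>)) \<partial>Q) +
      (\<integral>\<omega>. indicator A \<omega> * ((X t \<omega> - X s \<omega>) * (X t \<omega> - X s \<omega>)) \<partial>Q) +
      2 * (\<integral>\<omega>. indicator A \<omega> * ((X s \<omega> - X r \<omega>) * (X t \<omega> - X s \<omega>)) \<partial>Q)"
    using st by (simp add: Bochner_Integration.integral_add int)
  finally show ?thesis using orth by (simp add: power2_eq_square)
qed

text \<open>A maximal inequality in the manner of Doob and Kolmogorov. For finitely many times, the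
  first-entrance decomposition compares \<open>Q\<close> with a measure of total mass at most
  \<open>c / \<epsilon>\<^sup>2\<close>; all rational times follow by exhaustion.\<close>

lemma emeasure_bounded_martingale_oscillation:
  fixes X :: "real \<Rightarrow> 'a \<Rightarrow> real"
  assumes X: "cmartingale Q F X"
    and bnd: "\<And>t \<omega>. 0 \<le> t \<Longrightarrow> \<omega> \<in> space Q \<Longrightarrow> \<bar>X t \<omega>\<bar> \<le> B"
    and s: "0 \<le> s" and \<epsilon>: "0 < \<epsilon>"
    and c: "\<And>t. s \<le> t \<Longrightarrow> (\<integral>\<omega>. (X t \<omega> - X s \<omega>)\<^sup>2 \<partial>Q) \<le> c"
  shows "emeasure Q (\<Union>q\<in>\<rat> \<inter> {s..}. {\<omega>\<in>space Q. \<epsilon> < \<bar>X q \<omega> - X s \<omega>\<bar>}) \<le> ennreal (c / \<epsilon>\<^sup>2)"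
proof (rule emeasure_countable_UN_le)
  define E where "E q = {\<omega>\<in>space Q. \<epsilon> < \<bar>X q \<omega> - X s \<omega>\<bar>}" for q
  show "countable (\<rat> \<inter> {s..} :: real set)" using countable_rat by auto
  have F_meas: "X u \<in> borel_measurable (F u)" if "0 \<le> u" for u
    using X that by (auto simp: cmartingale_def)
  have Q_meas: "X u \<in> borel_measurable Q" if "0 \<le> u" for u
    using that F_meas measurable_F by blast
  have E: "E q \<in> sets (F q)" if "s \<le> q" for q
  proof -
    have [measurable]: "X q \<in> borel_measurable (F q)" "X s \<in> borel_measurable (F q)"
      using F_meas[of q] measurable_F_mono[OF s that F_meas[OF s]] that s by auto
    have "E q = {\<omega>\<in>space (F q). \<epsilon> < \<bar>X q \<omega> - X s \<omega>\<bar>}"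
      unfolding E_def using space_F[of q] that s by simp
    then show ?thesis by simp
  qed
  then show "{\<omega>\<in>space Q. \<epsilon> < \<bar>X q \<omega> - X s \<omega>\<bar>} \<in> events" if "q \<in> \<rat> \<inter> {s..}" for q
    using that s sets_F[of q "E q"] unfolding E_def by auto
  fix T :: "real set" assume T: "finite T" "T \<subseteq> \<rat> \<inter> {s..}"
  \<comment> \<open>The last time under consideration; inserting \<open>s\<close> covers empty
    \<open>T\<close> and guarantees \<open>s \<le> b\<close>.\<close>
  define b where "b = Max (insert s T)"
  have b: "s \<le> b" "\<And>t. t \<in> T \<Longrightarrow> t \<le> b" unfolding b_def using T by auto
  have [measurable]: "X b \<in> borel_measurable Q" "X s \<in> borel_measurable Q" using Q_meas b s by auto
  \<comment> \<open>The density of the comparison measure: the Chebyshev quotient at the final time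
    \<open>b\<close>, the same for all entrance times.\<close>
  define f where "f \<omega> = (X b \<omega> - X s \<omega>)\<^sup>2 / \<epsilon>\<^sup>2" for \<omega>
  have [measurable]: "f \<in> borel_measurable Q" unfolding f_def by simp
  have int: "integrable Q (\<lambda>\<omega>. indicator A \<omega> * (X u \<omega> - X s \<omega>)\<^sup>2)" if "A \<in> sets Q" "0 \<le> u" for A u
  proof (rule integrable_const_bound[where B="(2*B)\<^sup>2"])
    show "AE x in Q. norm (indicator A x * (X u x - X s x)\<^sup>2) \<le> (2*B)\<^sup>2"
    proof (rule AE_I2)
      fix \<omega> assume \<omega>: "\<omega> \<in> space Q"
      have "\<bar>X u \<omega> - X s \<omega>\<bar> \<le> 2 * B" using bnd[OF \<open>0 \<le> u\<close> \<omega>] bnd[OF s \<omega>] by linarith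
      then have "(X u \<omega> - X s \<omega>)\<^sup>2 \<le> (2*B)\<^sup>2" by (metis abs_ge_zero power2_abs power_mono)
      then show "norm (indicator A \<omega> * (X u \<omega> - X s \<omega>)\<^sup>2) \<le> (2*B)\<^sup>2"
        by (auto simp: indicator_def)
    qed
    show "(\<lambda>\<omega>. indicator A \<omega> * (X u \<omega> - X s \<omega>)\<^sup>2) \<in> borel_measurable Q"
      using Q_meas[OF \<open>0 \<le> u\<close>] that by measurable
  qed
  have dens: "emeasure (density Q f) A = ennreal (\<integral>\<omega>. indicator A \<omega> * (X b \<omega> - X s \<omega>)\<^sup>2 \<partial>Q / \<epsilon>\<^sup>2)"
    if A: "A \<in> sets Q" for A
  proof -
    have "emeasure (density Q f) A = (\<integral>\<^sup>+\<omega>. ennreal (indicator A \<omega> * (X b \<omega> - X s \<omega>)\<^sup>2 / \<epsilon>\<^sup>2) \<partial>Q)"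
      using A by (subst emeasure_density) (auto intro!: nn_integral_cong simp: f_def indicator_def)
    also have "\<dots> = ennreal (\<integral>\<omega>. indicator A \<omega> * (X b \<omega> - X s \<omega>)\<^sup>2 / \<epsilon>\<^sup>2 \<partial>Q)"
      using int[OF A, of b] b s by (intro nn_integral_eq_integral) auto
    finally show ?thesis by simp
  qed
  have "emeasure Q (\<Union>t\<in>T. E t) \<le> emeasure (density Q f) (\<Union>t\<in>T. E t)"
  proof (rule emeasure_finite_union_first_entrance)
    show "finite T" "T \<subseteq> {0..}" "\<And>t. t \<in> T \<Longrightarrow> E t \<in> sets (F t)" "sets (density Q f) = events"
      using T s E by force+
    \<comment> \<open>Inside \<open>E t\<close>, Chebyshev bounds the measure of \<open>A\<close> by
      the squared increment up to \<open>t\<close>. Since \<open>A\<close> belongs to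
      \<open>F t\<close>, the increment identity shows that replacing \<open>t\<close> by the later
      time \<open>b\<close> only enlarges the integral.\<close>
    fix t A assume t: "t \<in> T" and A: "A \<in> sets (F t)" "A \<subseteq> E t"
    have st: "s \<le> t" "0 \<le> t" using t T s by auto
    have AQ: "A \<in> sets Q" using sets_F[OF st(2) A(1)] .
    have "\<epsilon>\<^sup>2 * measure Q A = (\<integral>\<omega>. indicator A \<omega> * \<epsilon>\<^sup>2 \<partial>Q)"
      using AQ by (simp add: mult.commute)
    also have "\<dots> \<le> (\<integral>\<omega>. indicator A \<omega> * (X t \<omega> - X s \<omega>)\<^sup>2 \<partial>Q)"
    proof (rule integral_mono)
      show "integrable Q (\<lambda>\<omega>. indicator A \<omega> * \<epsilon>\<^sup>2)"
        using AQ by (intro integrable_mult_left) (auto simp: emeasure_eq_measure)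
      show "indicator A \<omega> * \<epsilon>\<^sup>2 \<le> indicator A \<omega> * (X t \<omega> - X s \<omega>)\<^sup>2" for \<omega>
        using A(2) \<epsilon> power_mono[of \<epsilon> "\<bar>X t \<omega> - X s \<omega>\<bar>" 2] by (auto simp: E_def indicator_def)
    qed (use int AQ st in auto)
    also have "\<dots> \<le> (\<integral>\<omega>. indicator A \<omega> * (X b \<omega> - X s \<omega>)\<^sup>2 \<partial>Q)"
    proof -
      have "0 \<le> (\<integral>\<omega>. indicator A \<omega> * (X b \<omega> - X t \<omega>)\<^sup>2 \<partial>Q)"
        by (intro integral_nonneg_AE) auto
      then show ?thesis
        using martingale_square_increment[OF X s st(1) b(2)[OF t] bnd A(1)] by auto
    qed
    finally have "measure Q A \<le> (\<integral>\<omega>. indicator A \<omega> * (X b \<omega> - X s \<omega>)\<^sup>2 \<partial>Q) / \<epsilon>\<^sup>2"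
      using \<epsilon> by (simp add: field_simps)
    then show "emeasure Q A \<le> emeasure (density Q f) A"
      unfolding dens[OF AQ] emeasure_eq_measure by (rule ennreal_leI)
  qed
  also have "\<dots> \<le> emeasure (density Q f) (space Q)"
    by (metis emeasure_space space_density)
  also have "\<dots> = ennreal ((\<integral>\<omega>. indicator (space Q) \<omega> * (X b \<omega> - X s \<omega>)\<^sup>2 \<partial>Q) / \<epsilon>\<^sup>2)"
    by (rule dens) simp
  also have "(\<integral>\<omega>. indicator (space Q) \<omega> * (X b \<omega> - X s \<omega>)\<^sup>2 \<partial>Q) = (\<integral>\<omega>. (X b \<omega> - X s \<omega>)\<^sup>2 \<partial>Q)"
    by (rule Bochner_Integration.integral_cong) auto
  also have "ennreal (\<dots> / \<epsilon>\<^sup>2) \<le> ennreal (c / \<epsilon>\<^sup>2)"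
    by (intro ennreal_leI divide_right_mono c b) simp
  finally show "emeasure Q (\<Union>t\<in>T. {\<omega>\<in>space Q. \<epsilon> < \<bar>X t \<omega> - X s \<omega>\<bar>}) \<le> ennreal (c / \<epsilon>\<^sup>2)"
    unfolding E_def .
qed

text \<open>By the increment identity the second moment \<open>a t\<close> of
  \<open>X t - X 0\<close> grows with \<open>t\<close>, each growth being the second moment of the
  intermediate increment. It is bounded by \<open>(2*B)\<^sup>2\<close>, so any \<open>n\<close>
  with \<open>a n\<close> within \<open>\<delta>\<close> of the supremum works.\<close>

lemma bounded_martingale_L2_Cauchy:
  fixes X :: "real \<Rightarrow> 'a \<Rightarrow> real"
  assumes X: "cmartingale Q F X"
    and bnd: "\<And>t \<omega>. 0 \<le> t \<Longrightarrow> \<omega> \<in> space Q \<Longrightarrow> \<bar>X t \<omega>\<bar> \<le> B"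
    and "0 < \<delta>"
  shows "\<exists>n::nat. \<forall>t\<ge>real n. (\<integral>\<omega>. (X t \<omega> - X (real n) \<omega>)\<^sup>2 \<partial>Q) \<le> \<delta>"
proof -
  define a where "a t = (\<integral>\<omega>. (X t \<omega> - X 0 \<omega>)\<^sup>2 \<partial>Q)" for t
  have inc: "a t = a s + (\<integral>\<omega>. (X t \<omega> - X s \<omega>)\<^sup>2 \<partial>Q)" if "0 \<le> s" "s \<le> t" for s t
  proof -
    have [simp]: "(\<integral>\<omega>. indicator (space Q) \<omega> * f \<omega> \<partial>Q) = (\<integral>\<omega>. f \<omega> \<partial>Q)" for f :: "'a \<Rightarrow> real"
      by (rule Bochner_Integration.integral_cong) auto
    have "space Q \<in> sets (F s)" using space_F[OF that(1)] by (metis sets.top)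
    from martingale_square_increment[OF X order_refl that bnd this]
    show ?thesis by (simp add: a_def)
  qed
  have pos: "0 \<le> (\<integral>\<omega>. (X t \<omega> - X s \<omega>)\<^sup>2 \<partial>Q)" for s t by (rule integral_nonneg_AE) auto
  have mono: "a s \<le> a t" if "0 \<le> s" "s \<le> t" for s t using inc[OF that] pos[of t s] by simp
  have bdd: "a t \<le> (2*B)\<^sup>2" if "0 \<le> t" for t
  proof -
    have m: "X u \<in> borel_measurable Q" if "0 \<le> u" for u
      using X that measurable_F[of u "X u"] by (auto simp: cmartingale_def)
    have le: "(X t \<omega> - X 0 \<omega>)\<^sup>2 \<le> (2*B)\<^sup>2" if "\<omega> \<in> space Q" for \<omega>
    proof -
      have "\<bar>X t \<omega> - X 0 \<omega>\<bar> \<le> 2 * B" using bnd[OF \<open>0 \<le> t\<close> that] bnd[OF order_refl that] by linarith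
      then show ?thesis by (metis abs_ge_zero power2_abs power_mono)
    qed
    have "a t \<le> (\<integral>\<omega>. (2*B)\<^sup>2 \<partial>Q)" unfolding a_def
    proof (rule integral_mono)
      show "integrable Q (\<lambda>\<omega>. (X t \<omega> - X 0 \<omega>)\<^sup>2)"
        by (rule integrable_const_bound[where B="(2*B)\<^sup>2"]) (use le m[OF that] m[of 0] in auto)
    qed (use le in auto)
    then show ?thesis by (simp add: prob_space)
  qed
  have bdd': "bdd_above (range (\<lambda>n. a (real n)))" using bdd by (intro bdd_aboveI[of _ "(2*B)\<^sup>2"]) auto
  define s where "s = (SUP n. a (real n))"
  have "s - \<delta> < s" using \<open>0 < \<delta>\<close> by simp
  then obtain n where n: "s - \<delta> < a (real n)"
    unfolding s_def using less_cSUP_iff[OF _ bdd'] by auto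
  have "(\<integral>\<omega>. (X t \<omega> - X (real n) \<omega>)\<^sup>2 \<partial>Q) \<le> \<delta>" if t: "real n \<le> t" for t
  proof -
    \<comment> \<open>The supremum runs over integer times only; rounding \<open>t\<close> up and
      monotonicity bring real times below it.\<close>
    have "a t \<le> a (real (nat \<lceil>t\<rceil>))" by (rule mono) (use t in linarith)+
    also have "\<dots> \<le> s" unfolding s_def by (rule cSUP_upper[OF _ bdd']) simp
    finally show ?thesis using inc[OF _ t] n by simp
  qed
  then show ?thesis by blast
qed

text \<open>Almost surely, for every tolerance there is an integer time after which the path stays
  within that tolerance of its value there. Such a path is Cauchy at infinity, and the real line is
  complete.\<close>

lemma bounded_martingale_AE_convergent:
  fixes X :: "real \<Rightarrow> 'a \<Rightarrow> real"
  assumes X: "cmartingale Q F X"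
    and bnd: "\<And>t \<omega>. 0 \<le> t \<Longrightarrow> \<omega> \<in> space Q \<Longrightarrow> \<bar>X t \<omega>\<bar> \<le> B"
    and rc: "AE \<omega> in Q. \<forall>t\<ge>0. ((\<lambda>s. X s \<omega>) \<longlongrightarrow> X t \<omega>) (at_right t)"
  shows "AE \<omega> in Q. \<exists>l. ((\<lambda>t. X t \<omega>) \<longlongrightarrow> l) at_top"
proof -
  \<comment> \<open>Only rational times enter, so that the exceptional event is a countable union
    and hence measurable.\<close>
  define Bad where "Bad n \<epsilon> = (\<Union>q\<in>\<rat> \<inter> {real n..}. {\<omega>\<in>space Q. \<epsilon> < \<bar>X q \<omega> - X (real n) \<omega>\<bar>})" for n \<epsilon>
  have m [measurable]: "X u \<in> borel_measurable Q" if "0 \<le> u" for u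
    using X that measurable_F[of u "X u"] by (auto simp: cmartingale_def)
  have Bad_meas: "Bad n \<epsilon> \<in> sets Q" for n \<epsilon>
    unfolding Bad_def
  proof (rule sets.countable_UN'')
    fix q :: real assume "q \<in> \<rat> \<inter> {real n..}"
    then have [measurable]: "X q \<in> borel_measurable Q" by (intro m) auto
    show "{\<omega>\<in>space Q. \<epsilon> < \<bar>X q \<omega> - X (real n) \<omega>\<bar>} \<in> events" by measurable
  qed (use countable_rat in auto)
  have null: "AE \<omega> in Q. \<exists>n. \<omega> \<notin> Bad n \<epsilon>" if \<epsilon>: "0 < \<epsilon>" for \<epsilon>
  proof -
    have "emeasure Q (\<Inter>n. Bad n \<epsilon>) \<le> 0 + ennreal \<eta>" if \<eta>: "0 < \<eta>" for \<eta> :: real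
    proof -
      \<comment> \<open>The tolerance \<open>\<eta> * \<epsilon>\<^sup>2\<close> is chosen so that
        the division by \<open>\<epsilon>\<^sup>2\<close> in the maximal inequality leaves exactly
        \<open>\<eta>\<close>.\<close>
      obtain n where n: "\<And>t. real n \<le> t \<Longrightarrow> (\<integral>\<omega>. (X t \<omega> - X (real n) \<omega>)\<^sup>2 \<partial>Q) \<le> \<eta> * \<epsilon>\<^sup>2"
        using bounded_martingale_L2_Cauchy[OF X bnd, of "\<eta> * \<epsilon>\<^sup>2"] \<eta> \<epsilon> by auto
      have "emeasure Q (\<Inter>n. Bad n \<epsilon>) \<le> emeasure Q (Bad n \<epsilon>)"
        using Bad_meas by (intro emeasure_mono) auto
      also have "\<dots> \<le> ennreal (\<eta> * \<epsilon>\<^sup>2 / \<epsilon>\<^sup>2)"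
        unfolding Bad_def by (rule emeasure_bounded_martingale_oscillation[OF X bnd _ \<epsilon> n]) auto
      finally show ?thesis using \<epsilon> by simp
    qed
    then have "emeasure Q (\<Inter>n. Bad n \<epsilon>) = 0"
      using ennreal_le_epsilon[of 0 "emeasure Q (\<Inter>n. Bad n \<epsilon>)"] by auto
    then have "(\<Inter>n. Bad n \<epsilon>) \<in> null_sets Q" using Bad_meas by (intro null_setsI) auto
    from AE_not_in[OF this] show ?thesis by auto
  qed
  have "AE \<omega> in Q. \<forall>k. \<exists>n. \<omega> \<notin> Bad n (1 / real (Suc k))"
    unfolding AE_all_countable by (intro allI null) simp
  with rc AE_space show ?thesis
  proof eventually_elim
    case (elim \<omega>)
    have close: "\<exists>n. \<forall>t\<ge>real n. \<bar>X t \<omega> - X (real n) \<omega>\<bar> \<le> 1 / real (Suc k)" for k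
    proof -
      obtain n where n: "\<omega> \<notin> Bad n (1 / real (Suc k))" using elim by blast
      have "\<bar>X t \<omega> - X (real n) \<omega>\<bar> \<le> 1 / real (Suc k)" if t: "real n \<le> t" for t
      proof (rule ccontr)
        \<comment> \<open>A violation at a real time would persist, by right-continuity, at a
          slightly later rational time, contradicting \<open>n\<close>.\<close>
        assume "\<not> ?thesis"
        moreover have "((\<lambda>s. \<bar>X s \<omega> - X (real n) \<omega>\<bar>) \<longlongrightarrow> \<bar>X t \<omega> - X (real n) \<omega>\<bar>) (at_right t)"
          using elim(1) t by (intro tendsto_intros) auto
        ultimately have "eventually (\<lambda>s. 1 / real (Suc k) < \<bar>X s \<omega> - X (real n) \<omega>\<bar>) (at_right t)"
          by (intro order_tendstoD(1)) auto
        from rational_right_of[OF this] obtain q where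
          q: "q \<in> \<rat>" "t < q" "1 / real (Suc k) < \<bar>X q \<omega> - X (real n) \<omega>\<bar>" by blast
        then have "\<omega> \<in> Bad n (1 / real (Suc k))" unfolding Bad_def using elim(2) t by auto
        with n show False by simp
      qed
      then show ?thesis by blast
    qed
    have "cauchy_filter (filtermap (\<lambda>t. X t \<omega>) at_top)"
      unfolding cauchy_filter_metric_filtermap
    proof (intro allI impI)
      fix e :: real assume "0 < e"
      then obtain k where k: "1 / real (Suc k) < e / 2" using nat_approx_posE[of "e/2"] by auto
      obtain n where n: "\<forall>t\<ge>real n. \<bar>X t \<omega> - X (real n) \<omega>\<bar> \<le> 1 / real (Suc k)" using close by blast
      have "dist (X x \<omega>) (X y \<omega>) < e" if "real n \<le> x" "real n \<le> y" for x y
        using n[rule_format, OF that(1)] n[rule_format, OF that(2)] k unfolding dist_real_def by linarith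
      then show "\<exists>P. eventually P at_top \<and> (\<forall>x y. P x \<and> P y \<longrightarrow> dist (X x \<omega>) (X y \<omega>) < e)"
        by (intro exI[of _ "\<lambda>x. real n \<le> x"]) (auto intro: eventually_ge_at_top)
    qed
    then show ?case
      using complete_uniform[where S="UNIV :: real set"] complete_UNIV[where 'a=real]
      by (force simp: filterlim_def)
  qed
qed

text \<open>Coordinates inherit the martingale property, the bound and right-continuity; the basis
  is finite, so the exceptional null sets can be united.\<close>

lemma bounded_martingale_AE_convergent_euclidean:
  fixes X :: "real \<Rightarrow> 'a \<Rightarrow> 'b::euclidean_space"
  assumes X: "cmartingale Q F X"
    and bnd: "\<And>t \<omega>. 0 \<le> t \<Longrightarrow> \<omega> \<in> space Q \<Longrightarrow> norm (X t \<omega>) \<le> B"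
    and rc: "AE \<omega> in Q. \<forall>t\<ge>0. ((\<lambda>s. X s \<omega>) \<longlongrightarrow> X t \<omega>) (at_right t)"
  shows "AE \<omega> in Q. \<exists>l. ((\<lambda>t. X t \<omega>) \<longlongrightarrow> l) at_top"
proof -
  have "AE \<omega> in Q. \<exists>l. ((\<lambda>t. X t \<omega> \<bullet> b) \<longlongrightarrow> l) at_top" if b: "b \<in> Basis" for b
  proof (rule bounded_martingale_AE_convergent[where B=B])
    show "cmartingale Q F (\<lambda>t \<omega>. X t \<omega> \<bullet> b)"
      by (rule cmartingale_bounded_linear[OF bounded_linear_inner_left X subalgebra_F])
    show "\<bar>X t \<omega> \<bullet> b\<bar> \<le> B" if "0 \<le> t" "\<omega> \<in> space Q" for t \<omega>
      using Basis_le_norm[OF b, of "X t \<omega>"] bnd[OF that] by linarith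
    show "AE \<omega> in Q. \<forall>t\<ge>0. ((\<lambda>s. X s \<omega> \<bullet> b) \<longlongrightarrow> X t \<omega> \<bullet> b) (at_right t)"
      using rc by eventually_elim (auto intro: tendsto_intros)
  qed
  then have "AE \<omega> in Q. \<forall>b\<in>Basis. \<exists>l. ((\<lambda>t. X t \<omega> \<bullet> b) \<longlongrightarrow> l) at_top"
    by (intro AE_finite_allI) auto
  then show ?thesis
  proof eventually_elim
    case (elim \<omega>)
    then obtain l where l: "\<forall>b\<in>Basis. ((\<lambda>t. X t \<omega> \<bullet> b) \<longlongrightarrow> l b) at_top" by metis
    then have "((\<lambda>t. X t \<omega>) \<longlongrightarrow> (\<Sum>b\<in>Basis. l b *\<^sub>R b)) at_top"
      by (subst tendsto_componentwise_iff) simp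
    then show ?case by blast
  qed
qed

end

section \<open>Gram matrices and density matrices\<close>

text \<open>Isolates the dependence of \<open>Mproc\<close> on the current matrix, so that
  boundedness, continuity and measurability become facts about a single map on matrices.\<close>

definition normalized_gram :: "'k::finite cmat \<Rightarrow> 'k cmat \<Rightarrow> 'k cmat" where
  "normalized_gram M0 A = (if mtrace (adj A ** A) \<noteq> 0
     then cscale (1 / mtrace (adj A ** A)) (adj A ** A) else M0)"

lemma Mproc_eq_normalized_gram: "Mproc S M0 t \<omega> = normalized_gram M0 (S t \<omega>)"
  by (simp add: Mproc_def normalized_gram_def)

lemma gram_nth: "(adj A ** A) $ i $ j = (\<Sum>l\<in>UNIV. cnj (A $ l $ i) * A $ l $ j)"
  by (simp add: matrix_matrix_mult_def adj_def)

lemma mtrace_gram: "mtrace (adj A ** A) = of_real (\<Sum>i\<in>UNIV. \<Sum>l\<in>UNIV. (norm (A $ l $ i))\<^sup>2)"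
  unfolding mtrace_def gram_nth of_real_sum complex_norm_square by (simp add: mult.commute)

text \<open>The trace is the squared Hilbert-Schmidt norm. Consequently the default value
  \<open>M0\<close> is taken exactly at the zero matrix.\<close>

lemma mtrace_gram_eq_0_iff: "mtrace (adj A ** A) = 0 \<longleftrightarrow> A = 0"
  unfolding mtrace_gram of_real_eq_0_iff
  by (simp add: sum_nonneg_eq_0_iff sum_nonneg vec_eq_iff) blast

text \<open>Entry \<open>(i, j)\<close> is the inner product of columns \<open>i\<close> and
  \<open>j\<close>. The inequality between geometric and arithmetic means bounds it by the mean of
  the two squared column norms, each of which is at most the trace; \<open>i = j\<close> needs no
  separate case.\<close>

lemma norm_gram_nth_le: "norm ((adj A ** A) $ i $ j) \<le> Re (mtrace (adj A ** A))"
proof -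
  define n :: "_ \<Rightarrow> real" where "n i = (\<Sum>l\<in>UNIV. (norm (A $ l $ i))\<^sup>2)" for i
  have n: "n i \<le> (\<Sum>i\<in>UNIV. n i)" for i
    by (rule member_le_sum) (auto simp: n_def sum_nonneg)
  have "norm ((adj A ** A) $ i $ j) \<le> (\<Sum>l\<in>UNIV. norm (A $ l $ i) * norm (A $ l $ j))"
    unfolding gram_nth by (rule order_trans[OF norm_sum]) (simp add: norm_mult)
  also have "\<dots> \<le> (\<Sum>l\<in>UNIV. ((norm (A $ l $ i))\<^sup>2 + (norm (A $ l $ j))\<^sup>2) / 2)"
  proof (rule sum_mono)
    fix l
    show "norm (A $ l $ i) * norm (A $ l $ j) \<le> ((norm (A $ l $ i))\<^sup>2 + (norm (A $ l $ j))\<^sup>2) / 2"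
      using sum_squares_bound[of "norm (A $ l $ i)" "norm (A $ l $ j)"] by simp
  qed
  also have "\<dots> = (n i + n j) / 2"
    by (simp add: n_def sum.distrib sum_divide_distrib[symmetric])
  also have "\<dots> \<le> (\<Sum>i\<in>UNIV. n i)" using add_mono[OF n[of i] n[of j]] by simp
  finally show ?thesis unfolding mtrace_gram n_def by simp
qed

lemma norm_matrix_le_sum: "norm (A :: complex^'n::finite^'m::finite) \<le> (\<Sum>i\<in>UNIV. \<Sum>j\<in>UNIV. norm (A $ i $ j))"
proof -
  have vec: "norm x \<le> (\<Sum>i\<in>UNIV. norm (x $ i))" for x :: "'b::real_normed_vector^'c::finite"
    unfolding norm_vec_def by (rule L2_set_le_sum) simp
  show ?thesis by (rule order_trans[OF vec]) (intro sum_mono vec)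
qed

text \<open>After normalisation every entry has modulus at most 1, which gives the square of the
  dimension; the summand \<open>norm M0\<close> accounts for the default value.\<close>

lemma norm_normalized_gram_le:
  "norm (normalized_gram M0 (A :: 'k::finite cmat)) \<le> real CARD('k) * real CARD('k) + norm M0"
proof (cases "mtrace (adj A ** A) = 0")
  case True
  then show ?thesis by (simp add: normalized_gram_def)
next
  case False
  define z where "z = mtrace (adj A ** A)"
  have "norm z \<noteq> 0" using False by (simp add: z_def)
  moreover have "norm z = Re z"
    unfolding z_def mtrace_gram norm_of_real Re_complex_of_real
    by (simp only: abs_of_nonneg[OF sum_nonneg[OF sum_nonneg]] zero_le_power2)
  ultimately have z: "norm z = Re z" "0 < Re z" using norm_ge_zero[of z] by linarith+
  have entry: "norm (normalized_gram M0 A $ i $ j) \<le> 1" for i j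
  proof -
    have "norm (normalized_gram M0 A $ i $ j) = norm ((adj A ** A) $ i $ j) / norm z"
      using False by (simp add: normalized_gram_def cscale_def z_def norm_divide norm_mult)
    also have "\<dots> \<le> 1" using norm_gram_nth_le[of A i j] z by (simp add: z_def divide_le_eq_1)
    finally show ?thesis .
  qed
  have "norm (normalized_gram M0 A) \<le> (\<Sum>i\<in>(UNIV::'k set). \<Sum>j\<in>(UNIV::'k set). 1)"
    by (rule order_trans[OF norm_matrix_le_sum]) (intro sum_mono entry)
  then show ?thesis using norm_ge_zero[of M0] by (simp del: norm_ge_zero)
qed

section \<open>Traces of products and their positivity\<close>

lemma mtrace_mult: "mtrace (A ** B) = (\<Sum>i\<in>UNIV. \<Sum>j\<in>UNIV. A $ i $ j * B $ j $ i)"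
  by (simp add: mtrace_def matrix_matrix_mult_def)

lemma mtrace_mult_commute: "mtrace (A ** B) = mtrace (B ** A)"
  unfolding mtrace_mult by (subst sum.swap) (simp add: mult.commute)

lemma mtrace_mult_mat: "mtrace (A ** mat c) = c * mtrace A"
  unfolding mtrace_mult
  by (simp add: mat_def mtrace_def sum_distrib_left if_distrib mult.commute cong: if_cong)

lemma mtrace_mult_cscale: "mtrace (A ** cscale c B) = c * mtrace (A ** B)"
  by (simp add: mtrace_mult cscale_def sum_distrib_left mult.left_commute)

lemma bounded_linear_mtrace_mult: "bounded_linear (\<lambda>X. c * mtrace (\<rho> ** X))"
  unfolding mtrace_mult
  by (intro bounded_linear_const_mult bounded_linear_sum bounded_linear_compose[OF bounded_linear_vec_nth] bounded_linear_vec_nth)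

text \<open>The trace is the sum of the values of the quadratic form of \<open>\<rho>\<close> at the conjugated rows of \<open>A\<close>.\<close>

lemma mtrace_gram_mult_psd:
  assumes "psd \<rho>"
  shows "mtrace (adj A ** A ** \<rho>) \<in> \<real>" and "0 \<le> Re (mtrace (adj A ** A ** \<rho>))"
proof -
  define v where "v l = (\<chi> i. cnj (A $ l $ i))" for l
  define q where "q l = (\<Sum>i\<in>UNIV. \<Sum>j\<in>UNIV. cnj (v l $ i) * \<rho> $ i $ j * v l $ j)" for l
  have "mtrace (adj A ** A ** \<rho>) = (\<Sum>i\<in>UNIV. \<Sum>j\<in>UNIV. \<Sum>l\<in>UNIV. cnj (A $ l $ i) * A $ l $ j * \<rho> $ j $ i)"
    unfolding mtrace_mult gram_nth sum_distrib_right ..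
  also have "\<dots> = (\<Sum>j\<in>UNIV. \<Sum>i\<in>UNIV. \<Sum>l\<in>UNIV. cnj (A $ l $ i) * A $ l $ j * \<rho> $ j $ i)"
    by (rule sum.swap)
  also have "\<dots> = (\<Sum>j\<in>UNIV. \<Sum>l\<in>UNIV. \<Sum>i\<in>UNIV. cnj (A $ l $ i) * A $ l $ j * \<rho> $ j $ i)"
    by (rule sum.cong[OF refl], rule sum.swap)
  also have "\<dots> = (\<Sum>l\<in>UNIV. \<Sum>j\<in>UNIV. \<Sum>i\<in>UNIV. cnj (A $ l $ i) * A $ l $ j * \<rho> $ j $ i)"
    by (rule sum.swap)
  also have "\<dots> = (\<Sum>l\<in>UNIV. q l)"
    by (simp add: q_def v_def mult_ac)
  finally have eq: "mtrace (adj A ** A ** \<rho>) = (\<Sum>l\<in>UNIV. q l)" .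
  have q: "q l \<in> \<real>" "0 \<le> Re (q l)" for l using assms unfolding psd_def q_def by blast+
  show "mtrace (adj A ** A ** \<rho>) \<in> \<real>" "0 \<le> Re (mtrace (adj A ** A ** \<rho>))"
    unfolding eq using q by (auto intro!: sum_nonneg)
qed

section \<open>Density matrices as test states\<close>

lemma density_matrix_chaotic: "density_matrix (mat (1 / of_nat CARD('k)) :: 'k::finite cmat)"
proof -
  have "(\<Sum>i\<in>UNIV. \<Sum>j\<in>UNIV. cnj (v $ i) * (mat (1 / of_nat CARD('k)) :: 'k cmat) $ i $ j * v $ j)
     = of_real ((\<Sum>i\<in>UNIV. (norm (v $ i))\<^sup>2) / real CARD('k))" (is "?l v = ?r v") for v :: "complex^'k"
  proof -
    have "?l v = (\<Sum>i\<in>UNIV. cnj (v $ i) * (1 / of_nat CARD('k)) * v $ i)"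
      by (simp add: mat_def if_distrib if_distribR cong: if_cong)
    also have "\<dots> = ?r v"
      by (simp add: sum_divide_distrib complex_norm_square[simplified of_real_power] mult.commute)
    finally show ?thesis .
  qed
  then have "psd (mat (1 / of_nat CARD('k)) :: 'k cmat)"
    unfolding psd_def by (simp add: sum_nonneg)
  then show ?thesis by (simp add: density_matrix_def mtrace_def mat_def)
qed

text \<open>This is the projection onto the line of \<open>v\<close>: its quadratic form at
  \<open>w\<close> is the squared modulus of the inner product of \<open>w\<close> and
  \<open>v\<close>, divided by \<open>n\<close>.\<close>

lemma density_matrix_rank_one:
  fixes v :: "complex^'k::finite"
  assumes "v \<noteq> 0"
  defines "n \<equiv> \<Sum>i\<in>UNIV. (norm (v $ i))\<^sup>2"
  shows "density_matrix (\<chi> i j. v $ i * cnj (v $ j) / of_real n)"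
proof -
  have n: "n > 0"
  proof -
    obtain i where "v $ i \<noteq> 0" using assms(1) by (auto simp: vec_eq_iff)
    then show ?thesis unfolding n_def by (intro sum_pos2[of _ i]) auto
  qed
  have "(\<Sum>i\<in>UNIV. \<Sum>j\<in>UNIV. cnj (w $ i) * (\<chi> i j. v $ i * cnj (v $ j) / of_real n) $ i $ j * w $ j)
    = of_real ((norm (\<Sum>i\<in>UNIV. cnj (w $ i) * v $ i))\<^sup>2 / n)" for w :: "complex^'k"
  proof -
    have "(\<Sum>i\<in>UNIV. \<Sum>j\<in>UNIV. cnj (w $ i) * (\<chi> i j. v $ i * cnj (v $ j) / of_real n) $ i $ j * w $ j)
      = (\<Sum>i\<in>UNIV. cnj (w $ i) * v $ i) * (\<Sum>j\<in>UNIV. cnj (cnj (w $ j) * v $ j)) / of_real n"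
      by (simp add: sum_product sum_divide_distrib mult_ac)
    also have "\<dots> = of_real ((norm (\<Sum>i\<in>UNIV. cnj (w $ i) * v $ i))\<^sup>2 / n)"
      by (simp only: of_real_divide complex_norm_square cnj_sum)
    finally show ?thesis .
  qed
  then have "psd (\<chi> i j. v $ i * cnj (v $ j) / of_real n)"
    unfolding psd_def using n by simp
  moreover have "mtrace (\<chi> i j. v $ i * cnj (v $ j) / of_real n) = of_real n / of_real n"
  proof -
    have "of_real n = (\<Sum>i\<in>UNIV. v $ i * cnj (v $ i))"
      unfolding n_def of_real_sum complex_norm_square ..
    then have "of_real n / of_real n = (\<Sum>i\<in>UNIV. v $ i * cnj (v $ i)) / complex_of_real n" by simp
    then show ?thesis by (simp add: mtrace_def sum_divide_distrib)
  qed
  ultimately show ?thesis using n by (simp add: density_matrix_def)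
qed

text \<open>Rank-one density matrices recover the quadratic form of a matrix, hence, by complex
  polarization, the matrix itself.\<close>

lemma density_matrices_separate:
  fixes X Y :: "'k::finite cmat"
  assumes "\<And>\<rho>. density_matrix \<rho> \<Longrightarrow> mtrace (\<rho> ** X) = mtrace (\<rho> ** Y)"
  shows "X = Y"
proof -
  define D where "D = X - Y"
  have D: "mtrace (\<rho> ** D) = 0" if "density_matrix \<rho>" for \<rho>
    using assms[OF that] by (simp add: D_def mtrace_mult right_diff_distrib sum_subtractf)
  have quad: "(\<Sum>i\<in>UNIV. \<Sum>j\<in>UNIV. v $ i * cnj (v $ j) * D $ j $ i) = 0" for v :: "complex^'k"
  proof (cases "v = 0")
    case False
    have "(\<Sum>i\<in>UNIV. (norm (v $ i))\<^sup>2) \<noteq> 0"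
      using False by (simp add: sum_nonneg_eq_0_iff vec_eq_iff)
    moreover have "(\<Sum>i\<in>UNIV. \<Sum>j\<in>UNIV. v $ i * cnj (v $ j) * D $ j $ i) /
        of_real (\<Sum>i\<in>UNIV. (norm (v $ i))\<^sup>2) = 0"
      using D[OF density_matrix_rank_one[OF False]]
      unfolding mtrace_mult vec_lambda_beta times_divide_eq_left sum_divide_distrib .
    ultimately show ?thesis by (simp only: divide_eq_0_iff of_real_eq_0_iff simp_thms)
  qed simp
  have pol: "D $ i $ i + cnj c * D $ j $ i + c * D $ i $ j + c * cnj c * D $ j $ j = 0" for i j c
  proof -
    \<comment> \<open>The polarization vector: the \<open>i\<close>-th unit vector plus
      \<open>c\<close> times the \<open>j\<close>-th one. Writing it as a sum of two conditionals
      also covers \<open>i = j\<close>.\<close>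
    define v :: "complex^'k" where "v = (\<chi> l. (if l = i then 1 else 0) + (if l = j then c else 0))"
    have cnjv: "cnj (v $ l) = (if l = i then 1 else 0) + (if l = j then cnj c else 0)" for l
      by (simp add: v_def)
    have "(\<Sum>m\<in>UNIV. v $ l * cnj (v $ m) * D $ m $ l) = v $ l * (D $ i $ l + cnj c * D $ j $ l)" for l
    proof -
      have "(\<Sum>m\<in>UNIV. v $ l * cnj (v $ m) * D $ m $ l) = v $ l * (\<Sum>m\<in>UNIV. cnj (v $ m) * D $ m $ l)"
        by (simp add: sum_distrib_left mult.assoc)
      also have "(\<Sum>m\<in>UNIV. cnj (v $ m) * D $ m $ l) = D $ i $ l + cnj c * D $ j $ l"
        unfolding cnjv by (simp add: distrib_right sum.distrib if_distrib[of "\<lambda>x. x * _"] cong: if_cong)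
      finally show ?thesis .
    qed
    then have "(\<Sum>l\<in>UNIV. v $ l * (D $ i $ l + cnj c * D $ j $ l)) = 0" using quad[of v] by simp
    moreover have "(\<Sum>l\<in>UNIV. v $ l * (D $ i $ l + cnj c * D $ j $ l))
       = (D $ i $ i + cnj c * D $ j $ i) + c * (D $ i $ j + cnj c * D $ j $ j)"
      by (simp add: v_def distrib_right sum.distrib if_distrib[of "\<lambda>x. x * _"] cong: if_cong)
    ultimately show ?thesis by (simp add: algebra_simps)
  qed
  \<comment> \<open>The choice \<open>c = 0\<close> leaves only the diagonal entry;
    \<open>c = 1\<close> and \<open>c = \<i>\<close> then give the sum and the difference of the two
    off-diagonal entries.\<close>
  have diag: "D $ i $ i = 0" for i using pol[where c=0] by simp
  have "D $ i $ j = 0" for i j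
  proof -
    have a: "D $ j $ i + D $ i $ j = 0" using pol[where c=1 and i=i and j=j] by (simp add: diag)
    have "\<i> * (D $ i $ j - D $ j $ i) = 0"
      using pol[where c=\<i> and i=i and j=j] by (simp add: diag algebra_simps)
    with a show ?thesis by auto
  qed
  then have "D = 0" by (simp add: vec_eq_iff)
  then show ?thesis by (simp add: D_def)
qed

section \<open>Continuity and measurability of the normalised Gram map\<close>

lemma continuous_on_gram: "continuous_on UNIV (\<lambda>A :: 'k::finite cmat. adj A ** A)"
  unfolding matrix_matrix_mult_def adj_def by (auto intro!: continuous_intros)

lemma continuous_on_mtrace: "continuous_on UNIV (mtrace :: 'k::finite cmat \<Rightarrow> complex)"
  unfolding mtrace_def by (auto intro!: continuous_intros)

lemma continuous_on_mtrace_gram_mult: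
  "continuous_on UNIV (\<lambda>A :: 'k::finite cmat. mtrace (adj A ** A ** \<rho>))"
  unfolding mtrace_mult gram_nth by (auto intro!: continuous_intros)

lemma continuous_on_mtrace_gram: "continuous_on UNIV (\<lambda>A :: 'k::finite cmat. mtrace (adj A ** A))"
  by (rule continuous_on_compose2[OF continuous_on_mtrace continuous_on_gram]) simp

text \<open>Zero is excluded because the arbitrary default is taken there; elsewhere the map is a
  quotient with nonvanishing denominator.\<close>

lemma continuous_on_normalized_gram:
  "continuous_on (- {0}) (normalized_gram M0 :: 'k::finite cmat \<Rightarrow> _)"
proof -
  have "continuous_on (- {0}) (\<lambda>A :: 'k cmat. cscale (1 / mtrace (adj A ** A)) (adj A ** A))"
    unfolding cscale_def
    by (intro continuous_intros continuous_on_subset[OF continuous_on_mtrace_gram]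
          continuous_on_subset[OF continuous_on_gram])
       (auto simp: mtrace_gram_eq_0_iff)
  then show ?thesis
    by (rule continuous_on_cong[THEN iffD1, rotated -1]) (auto simp: normalized_gram_def mtrace_gram_eq_0_iff)
qed

lemma measurable_normalized_gram [measurable]:
  "normalized_gram M0 \<in> borel_measurable (borel :: 'k::finite cmat measure)"
proof -
  have "(\<lambda>A. if A \<in> - {0} then normalized_gram M0 A else M0) \<in> borel_measurable (borel :: 'k cmat measure)"
    by (rule borel_measurable_continuous_on_if) (auto intro: continuous_on_normalized_gram)
  moreover have "(\<lambda>A. if A \<in> - {0} then normalized_gram M0 A else M0) = normalized_gram M0"
    by (auto simp: fun_eq_iff normalized_gram_def mtrace_gram_eq_0_iff)
  ultimately show ?thesis by simp
qed

text \<open>The trace cancels the normalisation, and at \<open>A = 0\<close> both sides vanish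
  whatever \<open>M0\<close> is. This is what makes the normalised process a density between the
  measures.\<close>

lemma mtrace_gram_mult_normalized_gram:
  "mtrace (adj A ** A) * mtrace (\<rho> ** normalized_gram M0 A) = mtrace (adj A ** A ** \<rho>)"
proof (cases "A = 0")
  case True
  then have "mtrace (adj A ** A) = 0" "mtrace (adj A ** A ** \<rho>) = 0"
    unfolding mtrace_gram_eq_0_iff by (simp_all add: mtrace_def)
  then show ?thesis by simp
next
  case False
  then show ?thesis
    by (simp add: normalized_gram_def mtrace_mult_cscale mtrace_gram_eq_0_iff
        mtrace_mult_commute[of \<rho> "adj A ** A"])
qed

section \<open>Changes of measure\<close>

text \<open>The density relation is available only on \<open>G\<close>. After restricting both
  measures to \<open>G\<close> it is an equality of measures, and restriction does not change
  integrals of \<open>G\<close>-measurable functions.\<close>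

lemma integral_density_on_subalgebra:
  fixes f :: "'a \<Rightarrow> 'b::{banach,second_countable_topology}"
  assumes P: "subalgebra P G" and Q: "subalgebra Q G"
    and Z: "Z \<in> borel_measurable G" "\<And>\<omega>. 0 \<le> Z \<omega>"
    and dens: "\<And>A. A \<in> sets G \<Longrightarrow> emeasure Q A = (\<integral>\<^sup>+\<omega>\<in>A. ennreal (Z \<omega>) \<partial>P)"
    and f: "f \<in> borel_measurable G"
  shows "(\<integral>\<omega>. f \<omega> \<partial>Q) = (\<integral>\<omega>. Z \<omega> *\<^sub>R f \<omega> \<partial>P)"
proof -
  have eq: "restr_to_subalg Q G = density (restr_to_subalg P G) (\<lambda>\<omega>. ennreal (Z \<omega>))"
  proof (rule measure_eqI)
    show "sets (restr_to_subalg Q G) = sets (density (restr_to_subalg P G) (\<lambda>\<omega>. ennreal (Z \<omega>)))"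
      using P Q by (simp add: sets_restr_to_subalg)
    fix A assume "A \<in> sets (restr_to_subalg Q G)"
    then have A [measurable]: "A \<in> sets G" using Q by (simp add: sets_restr_to_subalg)
    note [measurable] = Z(1)
    have "emeasure (restr_to_subalg Q G) A = (\<integral>\<^sup>+\<omega>\<in>A. ennreal (Z \<omega>) \<partial>P)"
      using emeasure_restr_to_subalg[OF Q A] dens[OF A] by simp
    also have "\<dots> = (\<integral>\<^sup>+\<omega>\<in>A. ennreal (Z \<omega>) \<partial>restr_to_subalg P G)"
      by (rule nn_integral_subalgebra2[OF P, symmetric]) measurable
    also have "\<dots> = emeasure (density (restr_to_subalg P G) (\<lambda>\<omega>. ennreal (Z \<omega>))) A"
      by (rule emeasure_density[symmetric])
        (use A Z P in \<open>auto simp: sets_restr_to_subalg intro!: measurable_in_subalg\<close>)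
    finally show "emeasure (restr_to_subalg Q G) A = \<dots>" .
  qed
  have "(\<integral>\<omega>. f \<omega> \<partial>Q) = (\<integral>\<omega>. f \<omega> \<partial>restr_to_subalg Q G)"
    by (rule integral_subalgebra2[OF Q f, symmetric])
  also have "\<dots> = (\<integral>\<omega>. Z \<omega> *\<^sub>R f \<omega> \<partial>restr_to_subalg P G)"
    unfolding eq by (rule integral_density) (use f Z P in \<open>auto intro: measurable_in_subalg\<close>)
  also have "\<dots> = (\<integral>\<omega>. Z \<omega> *\<^sub>R f \<omega> \<partial>P)"
    by (rule integral_subalgebra2[OF P]) (intro borel_measurable_scaleR Z f)
  finally show ?thesis .
qed

text \<open>The sets satisfying the identity form a Dynkin system: \<open>space Q \<in> G\<close>
  supplies the total mass used for complements, and both sides are countably additive on disjoint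
  unions.\<close>

lemma measure_eq_set_integral_sigma_sets:
  fixes g :: "'a \<Rightarrow> complex"
  assumes "finite_measure R" and R: "sets R = sets Q"
    and Q: "sets Q = sigma_sets (space Q) G" and G: "Int_stable G" "space Q \<in> G"
    and g: "integrable Q g"
    and eq: "\<And>A. A \<in> G \<Longrightarrow> complex_of_real (measure R A) = set_lebesgue_integral Q A g"
    and A: "A \<in> sets Q"
  shows "complex_of_real (measure R A) = set_lebesgue_integral Q A g"
proof -
  interpret R: finite_measure R by fact
  have sp: "space R = space Q" using R by (rule sets_eq_imp_space_eq)
  have si: "set_integrable Q A g" if "A \<in> sets Q" for A
    unfolding set_integrable_def using g that by (rule integrable_mult_indicator[rotated])
  have GP: "G \<subseteq> Pow (space Q)"
    using Q sets.space_closed[of Q] by (metis sigma_sets_superset_generator subset_trans)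
  show ?thesis
    using G(1) GP A[unfolded Q]
  proof (induction rule: sigma_sets_induct_disjoint)
    case (basic A)
    then show ?case by (rule eq)
  next
    case empty
    then show ?case by (simp add: set_lebesgue_integral_def)
  next
    case (compl A)
    then have A: "A \<in> sets Q" by (simp add: Q)
    have "complex_of_real (measure R (space Q - A)) =
        set_lebesgue_integral Q (space Q) g - set_lebesgue_integral Q A g"
      using R.finite_measure_compl[of A] A R compl.IH eq[OF G(2)] by (simp add: sp)
    moreover have "set_lebesgue_integral Q (A \<union> (space Q - A)) g =
        set_lebesgue_integral Q A g + set_lebesgue_integral Q (space Q - A) g"
      by (rule set_integral_Un) (use A si in auto)
    moreover have "A \<union> (space Q - A) = space Q" using sets.sets_into_space[OF A] by auto
    ultimately show ?case by simp
  next
    case (union A)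
    then have A: "range A \<subseteq> sets Q" by (simp add: Q)
    have "(\<lambda>i. measure R (A i)) sums measure R (\<Union>i. A i)"
      using A R union by (intro R.finite_measure_UNION) auto
    then have "(\<lambda>i. complex_of_real (measure R (A i))) sums complex_of_real (measure R (\<Union>i. A i))"
      by (rule sums_of_real)
    then have "complex_of_real (measure R (\<Union>i. A i)) = (\<Sum>i. set_lebesgue_integral Q (A i) g)"
      unfolding union.IH by (simp add: sums_iff)
    also have "\<dots> = set_lebesgue_integral Q (\<Union>i. A i) g"
      by (rule lebesgue_integral_countable_add[symmetric])
        (use A union in \<open>auto simp: disjoint_family_on_def intro!: si\<close>)
    finally show ?case .
  qed
qed

text \<open>The limit inherits the bound \<open>B\<close> almost everywhere, so the constant
  \<open>2 * B\<close> dominates the differences on a finite measure space.\<close>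

lemma (in finite_measure) bounded_convergence_L1_at_top:
  fixes X :: "real \<Rightarrow> 'a \<Rightarrow> 'b::{banach,second_countable_topology}"
  assumes X: "\<And>t. 0 \<le> t \<Longrightarrow> X t \<in> borel_measurable M" and Y: "Y \<in> borel_measurable M"
    and bnd: "\<And>t \<omega>. 0 \<le> t \<Longrightarrow> \<omega> \<in> space M \<Longrightarrow> norm (X t \<omega>) \<le> B"
    and lim: "AE \<omega> in M. ((\<lambda>t. X t \<omega>) \<longlongrightarrow> Y \<omega>) at_top"
  shows "((\<lambda>t. \<integral>\<^sup>+\<omega>. ennreal (norm (X t \<omega> - Y \<omega>)) \<partial>M) \<longlongrightarrow> 0) at_top"
proof -
  \<comment> \<open>Truncating time at 0 keeps every \<open>f t\<close> measurable and dominated,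
    although nothing is assumed about \<open>X\<close> at negative times; the limit at infinity is
    unaffected.\<close>
  define f where "f t \<omega> = norm (X (max 0 t) \<omega> - Y \<omega>)" for t \<omega>
  have f [measurable]: "f t \<in> borel_measurable M" for t
    unfolding f_def by (rule measurable_compose[OF borel_measurable_diff[OF X Y] borel_measurable_norm]) simp
  have Yb: "AE \<omega> in M. norm (Y \<omega>) \<le> B"
    using lim AE_space
  proof eventually_elim
    case (elim \<omega>)
    have "\<forall>\<^sub>F t in at_top. norm (X t \<omega>) \<le> B"
      using eventually_ge_at_top[of "0::real"] by eventually_elim (use bnd elim in auto)
    then show ?case by (rule Lim_norm_ubound[OF _ elim(1), rotated]) simp
  qed
  have fb: "AE \<omega> in M. norm (f t \<omega>) \<le> 2 * B" for t
    using Yb AE_space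
  proof eventually_elim
    case (elim \<omega>)
    then show ?case
      using norm_triangle_ineq4[of "X (max 0 t) \<omega>" "Y \<omega>"] bnd[of "max 0 t" \<omega>]
      by (simp add: f_def)
  qed
  have "((\<lambda>t. \<integral>\<omega>. f t \<omega> \<partial>M) \<longlongrightarrow> (\<integral>\<omega>. 0 \<partial>M)) at_top"
  proof (rule integral_dominated_convergence_at_top[where w="\<lambda>_. 2 * B"])
    show "AE \<omega> in M. ((\<lambda>t. f t \<omega>) \<longlongrightarrow> 0) at_top"
      using lim
    proof eventually_elim
      case (elim \<omega>)
      then have "((\<lambda>t. norm (X t \<omega> - Y \<omega>)) \<longlongrightarrow> 0) at_top"
        by (intro tendsto_norm_zero) (simp add: LIM_zero_iff Lim_null[symmetric])
      moreover have "\<forall>\<^sub>F t in at_top. norm (X t \<omega> - Y \<omega>) = f t \<omega>"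
        using eventually_ge_at_top[of "0::real"] by eventually_elim (simp add: f_def)
      ultimately show ?case by (rule Lim_transform_eventually)
    qed
  qed (use fb in auto)
  then have "((\<lambda>t. ennreal (\<integral>\<omega>. f t \<omega> \<partial>M)) \<longlongrightarrow> ennreal 0) at_top"
    by (intro tendsto_ennrealI) simp
  moreover have "\<forall>\<^sub>F t in at_top. ennreal (\<integral>\<omega>. f t \<omega> \<partial>M) = (\<integral>\<^sup>+\<omega>. ennreal (norm (X t \<omega> - Y \<omega>)) \<partial>M)"
    using eventually_ge_at_top[of "0::real"]
  proof eventually_elim
    case (elim t)
    have "integrable M (f t)" by (rule integrable_const_bound[OF fb f])
    then have "(\<integral>\<^sup>+\<omega>. ennreal (f t \<omega>) \<partial>M) = ennreal (\<integral>\<omega>. f t \<omega> \<partial>M)"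
      by (rule nn_integral_eq_integral) (simp add: f_def)
    then show ?case using elim by (simp add: f_def)
  qed
  ultimately have "((\<lambda>t. \<integral>\<^sup>+\<omega>. ennreal (norm (X t \<omega> - Y \<omega>)) \<partial>M) \<longlongrightarrow> ennreal 0) at_top"
    by (rule Lim_transform_eventually)
  then show ?thesis by simp
qed

context filtered_prob_space
begin

text \<open>On events of \<open>F q\<close> contained in \<open>{Z q < \<epsilon>}\<close> one has \<open>Q \<le> \<epsilon> P\<close>, so by decomposing along the
  first entrance time \<open>Z\<close> drops below \<open>\<epsilon>\<close> at some rational time with \<open>Q\<close>-probability at most \<open>\<epsilon>\<close>.\<close>

lemma AE_density_process_nonzero:
  assumes "prob_space P" and P: "sets P = sets Q"
    and Z: "\<And>t. 0 \<le> t \<Longrightarrow> Z t \<in> borel_measurable (F t)"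
    and dens: "\<And>t A. 0 \<le> t \<Longrightarrow> A \<in> sets (F t) \<Longrightarrow> emeasure Q A = (\<integral>\<^sup>+\<omega>\<in>A. ennreal (Z t \<omega>) \<partial>P)"
    and rc: "\<And>\<omega> t. \<omega> \<in> space Q \<Longrightarrow> 0 \<le> t \<Longrightarrow> ((\<lambda>s. Z s \<omega>) \<longlongrightarrow> Z t \<omega>) (at_right t)"
  shows "AE \<omega> in Q. \<forall>t\<ge>0. Z t \<omega> \<noteq> (0::real)"
proof -
  interpret P: prob_space P by fact
  define E where "E \<epsilon> t = {\<omega>\<in>space Q. Z t \<omega> < \<epsilon>}" for \<epsilon> t
  define Bad where "Bad \<epsilon> = (\<Union>q\<in>\<rat> \<inter> {0..}. E \<epsilon> q)" for \<epsilon>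
  have E: "E \<epsilon> t \<in> sets (F t)" if "0 \<le> t" for \<epsilon> t
  proof -
    have [measurable]: "Z t \<in> borel_measurable (F t)" using Z that .
    have "{\<omega>\<in>space (F t). Z t \<omega> < \<epsilon>} \<in> sets (F t)" by measurable
    then show ?thesis using space_F[OF that] by (simp add: E_def)
  qed
  have EQ: "E \<epsilon> t \<in> sets Q" if "0 \<le> t" for \<epsilon> t using sets_F[OF that E[OF that]] .
  have cnt: "countable (\<rat> \<inter> {0..} :: real set)" using countable_rat by auto
  have BQ: "Bad \<epsilon> \<in> sets Q" for \<epsilon>
    unfolding Bad_def using cnt EQ by (intro sets.countable_UN'') auto
  have small: "emeasure Q (Bad \<epsilon>) \<le> ennreal \<epsilon>" for \<epsilon>
    unfolding Bad_def
  proof (rule emeasure_countable_UN_le[OF cnt])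
    show "E \<epsilon> t \<in> events" if "t \<in> \<rat> \<inter> {0..}" for t using that EQ by auto
    fix T :: "real set" assume T: "finite T" "T \<subseteq> \<rat> \<inter> {0..}"
    have "emeasure Q (\<Union>t\<in>T. E \<epsilon> t) \<le> emeasure (scale_measure (ennreal \<epsilon>) P) (\<Union>t\<in>T. E \<epsilon> t)"
    proof (rule emeasure_finite_union_first_entrance[OF T(1)])
      fix t A assume t: "t \<in> T" and A: "A \<in> sets (F t)" "A \<subseteq> E \<epsilon> t"
      have t0: "0 \<le> t" using t T by auto
      have AP: "A \<in> sets P" using sets_F[OF t0 A(1)] P by simp
      have "emeasure Q A = (\<integral>\<^sup>+\<omega>\<in>A. ennreal (Z t \<omega>) \<partial>P)" using dens[OF t0 A(1)] .
      also have "\<dots> \<le> (\<integral>\<^sup>+\<omega>. ennreal \<epsilon> * indicator A \<omega> \<partial>P)"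
        using A(2) by (intro nn_integral_mono) (auto simp: indicator_def E_def intro!: ennreal_leI)
      also have "\<dots> = emeasure (scale_measure (ennreal \<epsilon>) P) A"
        using AP by (simp add: nn_integral_cmult_indicator)
      finally show "emeasure Q A \<le> \<dots>" .
    qed (use T E P in auto)
    also have "\<dots> \<le> ennreal \<epsilon> * 1"
      unfolding emeasure_scale_measure by (intro mult_left_mono P.emeasure_le_1) simp
    finally show "emeasure Q (\<Union>t\<in>T. E \<epsilon> t) \<le> ennreal \<epsilon>" by simp
  qed
  define N where "N = (\<Inter>n. Bad (1 / real (Suc n)))"
  have "emeasure Q N \<le> 0 + ennreal e" if e: "0 < e" for e
  proof -
    obtain n where n: "1 / real (Suc n) < e" using nat_approx_posE[OF e] by auto
    have "emeasure Q N \<le> emeasure Q (Bad (1 / real (Suc n)))"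
      unfolding N_def using BQ by (intro emeasure_mono) auto
    also have "\<dots> \<le> ennreal (1 / real (Suc n))" by (rule small)
    also have "\<dots> \<le> ennreal e" using n by (intro ennreal_leI) simp
    finally show ?thesis by simp
  qed
  then have "emeasure Q N = 0" using ennreal_le_epsilon[of 0 "emeasure Q N"] by auto
  then have "N \<in> null_sets Q" unfolding N_def using BQ by (intro null_setsI) auto
  from AE_not_in[OF this] AE_space show ?thesis
  proof eventually_elim
    case (elim \<omega>)
    show ?case
    proof (intro allI impI notI)
      \<comment> \<open>A zero at a real time forces, by right-continuity, values below every
        \<open>1 / real (Suc n)\<close> at rational times, so the path would lie in the null set
        \<open>N\<close>.\<close>
      fix t :: real assume t: "0 \<le> t" "Z t \<omega> = 0"
      have "\<omega> \<in> Bad (1 / real (Suc n))" for n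
      proof -
        have "\<forall>\<^sub>F s in at_right t. Z s \<omega> < 1 / real (Suc n)"
          using rc[OF elim(2) t(1)] t(2) by (intro order_tendstoD(2)) auto
        from rational_right_of[OF this] obtain q where "q \<in> \<rat>" "t < q" "Z q \<omega> < 1 / real (Suc n)"
          by blast
        then show ?thesis using t elim(2) unfolding Bad_def E_def by auto
      qed
      then show False using elim(1) unfolding N_def by auto
    qed
  qed
qed

end

section \<open>Convergence of the normalised process\<close>

theorem theorem2p4:
  fixes P :: "'a measure" and F :: "real \<Rightarrow> 'a measure"
    and S :: "real \<Rightarrow> 'a \<Rightarrow> complex^'k::finite^'k"
    and Prho :: "complex^'k^'k \<Rightarrow> 'a measure"
    and M0 :: "complex^'k^'k"
  assumes P: "prob_space P"
    and F: "usual_filtration P F"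
    and S_adapted: "\<forall>t\<ge>0. S t \<in> borel_measurable (F t)"
    and S_init: "\<forall>\<omega>\<in>space P. S 0 \<omega> = mat 1"
    and S_rc: "\<forall>\<omega>\<in>space P. \<forall>t\<ge>0. ((\<lambda>s. S s \<omega>) \<longlongrightarrow> S t \<omega>) (at_right t)"
    and S_ll: "\<forall>\<omega>\<in>space P. \<forall>t>0. \<exists>l. ((\<lambda>s. S s \<omega>) \<longlongrightarrow> l) (at_left t)"
    and Z_mart: "\<forall>\<rho>. density_matrix \<rho> \<longrightarrow>
        cmartingale P F (\<lambda>t \<omega>. mtrace (adj (S t \<omega>) ** S t \<omega> ** \<rho>))"
    and Prho: "\<forall>\<rho>. density_matrix \<rho> \<longrightarrow>
        prob_space (Prho \<rho>) \<and> sets (Prho \<rho>) = sets P \<and>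
        (\<forall>t\<ge>0. \<forall>A\<in>sets (F t). emeasure (Prho \<rho>) A =
            (\<integral>\<^sup>+\<omega>\<in>A. ennreal (Re (mtrace (adj (S t \<omega>) ** S t \<omega> ** \<rho>))) \<partial>P))"
  shows "let Pch = Prho (mat (1 / of_nat CARD('k))); M = Mproc S M0 in
     cmartingale Pch F M \<and>
     (\<exists>B. \<forall>t\<ge>0. \<forall>\<omega>\<in>space P. norm (M t \<omega>) \<le> B) \<and>
     (\<exists>Minf. Minf \<in> borel_measurable P \<and>
        (AE \<omega> in Pch. ((\<lambda>t. M t \<omega>) \<longlongrightarrow> Minf \<omega>) at_top) \<and>
        ((\<lambda>t. \<integral>\<^sup>+\<omega>. ennreal (norm (M t \<omega> - Minf \<omega>)) \<partial>Pch) \<longlongrightarrow> 0) at_top \<and>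
        (\<forall>\<rho>. density_matrix \<rho> \<longrightarrow>
           (\<forall>A\<in>sets P. complex_of_real (measure (Prho \<rho>) A) =
               set_lebesgue_integral Pch A (\<lambda>\<omega>. of_nat CARD('k) * mtrace (\<rho> ** Minf \<omega>))) \<and>
           (AE \<omega> in Prho \<rho>. ((\<lambda>t. M t \<omega>) \<longlongrightarrow> Minf \<omega>) at_top) \<and>
           ((\<lambda>t. \<integral>\<^sup>+\<omega>. ennreal (norm (M t \<omega> - Minf \<omega>)) \<partial>Prho \<rho>) \<longlongrightarrow> 0) at_top))"
proof -
  define ch :: "complex^'k^'k" where "ch = mat (1 / of_nat CARD('k))"
  define Q where "Q = Prho ch"
  define M where "M = Mproc S M0"
  \<comment> \<open>On \<open>F t\<close>, \<open>Re (g t \<rho>)\<close> is the density of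
    \<open>Prho \<rho>\<close> with respect to \<open>P\<close>, while \<open>h \<rho> (M t)\<close>
    will be its density with respect to \<open>Q\<close>.\<close>
  define g where "g t \<rho> \<omega> = mtrace (adj (S t \<omega>) ** S t \<omega> ** \<rho>)" for t \<rho> \<omega>
  define h where "h \<rho> X = of_nat CARD('k) * mtrace (\<rho> ** X)" for \<rho> X :: "complex^'k^'k"
  define B where "B = real CARD('k) * real CARD('k) + norm M0"
  have ch: "density_matrix ch" unfolding ch_def by (rule density_matrix_chaotic)
  have prob: "prob_space (Prho \<rho>)" and sets_rho: "sets (Prho \<rho>) = sets P"
    and dens: "0 \<le> t \<Longrightarrow> A \<in> sets (F t) \<Longrightarrow> emeasure (Prho \<rho>) A = (\<integral>\<^sup>+\<omega>\<in>A. ennreal (Re (g t \<rho> \<omega>)) \<partial>P)"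
    if "density_matrix \<rho>" for \<rho> t A
    using Prho that unfolding g_def by blast+
  have sets_Q: "sets Q = sets P" unfolding Q_def by (rule sets_rho[OF ch])
  have space_rho: "space (Prho \<rho>) = space P" if "density_matrix \<rho>" for \<rho>
    using sets_rho[OF that] by (rule sets_eq_imp_space_eq)
  have space_Q: "space Q = space P" unfolding Q_def by (rule space_rho[OF ch])
  note F' = F[unfolded usual_filtration_def]
  have F1: "space (F t) = space P \<and> sets (F t) \<subseteq> sets P" if "0 \<le> t" for t
    using F'[THEN conjunct1] that by blast
  have F2: "sets (F s) \<subseteq> sets (F t)" if "0 \<le> s" "s \<le> t" for s t
    using F'[THEN conjunct2, THEN conjunct1] that by blast
  have F3: "sets P = sigma_sets (space P) (\<Union>t\<in>{0..}. sets (F t))"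
    using F' by (elim conjE)
  have subP: "subalgebra P (F t)" if "0 \<le> t" for t using F1[OF that] by (simp add: subalgebra_def)
  have subQ: "subalgebra Q (F t)" if "0 \<le> t" for t
    using F1[OF that] sets_Q space_Q by (simp add: subalgebra_def)
  interpret Q: prob_space Q unfolding Q_def by (rule prob[OF ch])
  interpret Q: filtered_prob_space Q F by unfold_locales (use subQ F2 in auto)

  \<comment> \<open>Densities on each \<open>F t\<close> and the martingale property\<close>
  have S_F: "S t \<in> borel_measurable (F t)" if "0 \<le> t" for t using S_adapted that by blast
  have g_F: "g t \<rho> \<in> borel_measurable (F t)" if "0 \<le> t" for t \<rho>
    unfolding g_def by (rule borel_measurable_continuous_on[OF continuous_on_mtrace_gram_mult S_F[OF that]])
  have g_Re: "(\<lambda>\<omega>. Re (g t \<rho> \<omega>)) \<in> borel_measurable (F t)" if "0 \<le> t" for t \<rho>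
    by (rule borel_measurable_continuous_on[OF _ g_F[OF that]]) (intro continuous_intros)
  have g_pos: "0 \<le> Re (g t \<rho> \<omega>)" "g t \<rho> \<omega> = of_real (Re (g t \<rho> \<omega>))" if "density_matrix \<rho>" for t \<rho> \<omega>
    using mtrace_gram_mult_psd[of \<rho> "S t \<omega>"] that
    by (auto simp: g_def density_matrix_def)
  have M_eq: "M t \<omega> = normalized_gram M0 (S t \<omega>)" for t \<omega>
    unfolding M_def by (rule Mproc_eq_normalized_gram)
  have M_F: "M t \<in> borel_measurable (F t)" if "0 \<le> t" for t
    unfolding M_eq using measurable_compose[OF S_F[OF that] measurable_normalized_gram] .
  have M_Q: "M t \<in> borel_measurable Q" if "0 \<le> t" for t
    using M_F[OF that] by (rule Q.measurable_F[OF that])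
  have M_bnd: "norm (M t \<omega>) \<le> B" for t \<omega>
    unfolding M_eq B_def by (rule norm_normalized_gram_le)
  have M_int: "integrable Q (M t)" if "0 \<le> t" for t
    by (rule Q.integrable_const_bound[of _ B]) (use M_bnd M_Q[OF that] in auto)
  have h_lin: "bounded_linear (h \<rho>)" for \<rho>
    unfolding h_def by (rule bounded_linear_mtrace_mult)
  have h_set: "h \<rho> (set_lebesgue_integral Q A X) = set_lebesgue_integral Q A (\<lambda>\<omega>. h \<rho> (X \<omega>))"
    if "integrable Q X" "A \<in> sets Q" for \<rho> A and X :: "'a \<Rightarrow> complex^'k^'k"
  proof -
    interpret h: bounded_linear "h \<rho>" by (rule h_lin)
    show ?thesis
      unfolding set_lebesgue_integral_def h.scaleR[symmetric]
      by (intro integral_bounded_linear[OF h_lin, symmetric] integrable_mult_indicator that)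
  qed
  \<comment> \<open>The chain rule for densities. The factor \<open>1 / k\<close> in the chaotic
    state cancels the factor \<open>k\<close> in \<open>h\<close>.\<close>
  have g_ch: "of_real (Re (g t ch \<omega>)) * h \<rho> (M t \<omega>) = g t \<rho> \<omega>" for t \<rho> \<omega>
  proof -
    have "of_real (Re (g t ch \<omega>)) = mtrace (adj (S t \<omega>) ** S t \<omega>) / of_nat CARD('k)"
      using g_pos(2)[OF ch, of t \<omega>] by (simp add: g_def ch_def mtrace_mult_mat)
    then show ?thesis
      using mtrace_gram_mult_normalized_gram[of "S t \<omega>" \<rho> M0] by (simp add: h_def M_eq g_def)
  qed
  \<comment> \<open>Passing from \<open>Q\<close> to \<open>P\<close> multiplies the integrand by
    the density of \<open>Q\<close>; by \<open>g_ch\<close> the product is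
    \<open>g t \<rho>\<close>, which is real and nonnegative, so the integral is the mass that
    \<open>Prho \<rho>\<close> gives to \<open>A\<close>.\<close>
  have rep: "set_lebesgue_integral Q A (\<lambda>\<omega>. h \<rho> (M t \<omega>)) = complex_of_real (measure (Prho \<rho>) A)"
    if \<rho>: "density_matrix \<rho>" and t: "0 \<le> t" and A: "A \<in> sets (F t)" for \<rho> t A
  proof -
    have "h \<rho> \<circ> M t \<in> borel_measurable (F t)"
      unfolding comp_def
      by (rule borel_measurable_continuous_on[OF linear_continuous_on[OF h_lin] M_F[OF t]])
    then have "(\<lambda>\<omega>. indicator A \<omega> *\<^sub>R h \<rho> (M t \<omega>)) \<in> borel_measurable (F t)"
      using A by (intro borel_measurable_scaleR borel_measurable_indicator) (simp_all add: comp_def)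
    then have "set_lebesgue_integral Q A (\<lambda>\<omega>. h \<rho> (M t \<omega>))
        = (\<integral>\<omega>. Re (g t ch \<omega>) *\<^sub>R indicator A \<omega> *\<^sub>R h \<rho> (M t \<omega>) \<partial>P)"
      unfolding set_lebesgue_integral_def
      by (intro integral_density_on_subalgebra[OF subP[OF t] subQ[OF t] g_Re[OF t] g_pos(1)[OF ch]])
        (use dens[OF ch t] in \<open>auto simp: Q_def\<close>)
    also have "\<dots> = (\<integral>\<omega>. complex_of_real (indicator A \<omega> * Re (g t \<rho> \<omega>)) \<partial>P)"
    proof (rule Bochner_Integration.integral_cong[OF refl])
      fix \<omega>
      have "Re (g t ch \<omega>) *\<^sub>R indicator A \<omega> *\<^sub>R h \<rho> (M t \<omega>) = of_real (indicator A \<omega>) * g t \<rho> \<omega>"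
        using g_ch[of t \<omega> \<rho>] by (simp add: scaleR_conv_of_real mult_ac)
      also have "\<dots> = complex_of_real (indicator A \<omega> * Re (g t \<rho> \<omega>))"
        using g_pos(2)[OF \<rho>, of t \<omega>] by simp
      finally show "Re (g t ch \<omega>) *\<^sub>R indicator A \<omega> *\<^sub>R h \<rho> (M t \<omega>) = \<dots>" .
    qed
    also have "\<dots> = complex_of_real (\<integral>\<omega>. indicator A \<omega> * Re (g t \<rho> \<omega>) \<partial>P)"
      by (rule integral_complex_of_real)
    also have "(\<integral>\<omega>. indicator A \<omega> * Re (g t \<rho> \<omega>) \<partial>P) =
        enn2real (\<integral>\<^sup>+\<omega>. ennreal (indicator A \<omega> * Re (g t \<rho> \<omega>)) \<partial>P)"
    proof (rule integral_eq_nn_integral)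
      have "A \<in> sets P" using A F1[OF t] by auto
      then show "(\<lambda>\<omega>. indicator A \<omega> * Re (g t \<rho> \<omega>)) \<in> borel_measurable P"
        using measurable_from_subalg[OF subP[OF t] g_Re[OF t]]
        by (intro borel_measurable_times borel_measurable_indicator)
    qed (use g_pos[OF \<rho>] in auto)
    also have "(\<integral>\<^sup>+\<omega>. ennreal (indicator A \<omega> * Re (g t \<rho> \<omega>)) \<partial>P) = emeasure (Prho \<rho>) A"
      unfolding dens[OF \<rho> t A] by (rule nn_integral_cong) (auto simp: indicator_def)
    finally show ?thesis by (simp add: measure_def)
  qed
  have mart: "cmartingale Q F M"
    unfolding cmartingale_def
  proof (intro conjI allI impI)
    fix t :: real assume t: "0 \<le> t"
    show "M t \<in> borel_measurable (F t)" by (rule M_F[OF t])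
    show "integrable Q (M t)" by (rule M_int[OF t])
  next
    fix s t :: real and A assume st: "0 \<le> s" "s \<le> t" and A: "A \<in> sets (F s)"
    have t: "0 \<le> t" and At: "A \<in> sets (F t)" and AQ: "A \<in> sets Q"
      using st A F2[OF st] Q.sets_F[OF st(1) A] by auto
    show "set_lebesgue_integral Q A (M t) = set_lebesgue_integral Q A (M s)"
    proof (rule density_matrices_separate)
      fix \<rho> :: "complex^'k^'k" assume \<rho>: "density_matrix \<rho>"
      have "h \<rho> (set_lebesgue_integral Q A (M t)) = h \<rho> (set_lebesgue_integral Q A (M s))"
        unfolding h_set[OF M_int[OF t] AQ] h_set[OF M_int[OF st(1)] AQ]
          rep[OF \<rho> t At] rep[OF \<rho> st(1) A] ..
      then show "mtrace (\<rho> ** set_lebesgue_integral Q A (M t)) = mtrace (\<rho> ** set_lebesgue_integral Q A (M s))"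
        by (simp add: h_def)
    qed
  qed

  \<comment> \<open>Right-continuity of the paths almost surely under \<open>Q\<close>\<close>
  have Z_rc: "((\<lambda>s. Re (g s ch \<omega>)) \<longlongrightarrow> Re (g t ch \<omega>)) (at_right t)"
    if "\<omega> \<in> space Q" "0 \<le> t" for \<omega> t
  proof -
    have lim: "((\<lambda>s. S s \<omega>) \<longlongrightarrow> S t \<omega>) (at_right t)" using S_rc that space_Q by auto
    show ?thesis
      unfolding g_def
      by (intro tendsto_Re continuous_on_tendsto_compose[OF continuous_on_mtrace_gram_mult lim]) auto
  qed
  have nonzero: "AE \<omega> in Q. \<forall>t\<ge>0. Re (g t ch \<omega>) \<noteq> 0"
    by (rule Q.AE_density_process_nonzero[OF P sets_Q[symmetric] g_Re _ Z_rc])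
      (use dens[OF ch] in \<open>auto simp: Q_def\<close>)
  have M_rc: "AE \<omega> in Q. \<forall>t\<ge>0. ((\<lambda>s. M s \<omega>) \<longlongrightarrow> M t \<omega>) (at_right t)"
    using nonzero AE_space
  proof eventually_elim
    case (elim \<omega>)
    show ?case
    proof (intro allI impI)
      fix t :: real assume t: "0 \<le> t"
      \<comment> \<open>A zero matrix would make the density of \<open>Q\<close> vanish. Away from
        zero the normalised Gram map is continuous and transfers right-continuity from
        \<open>S\<close> to \<open>M\<close>.\<close>
      have "S t \<omega> \<noteq> 0"
      proof
        assume "S t \<omega> = 0"
        then have "g t ch \<omega> = 0" by (simp add: g_def mtrace_def)
        then show False using elim(1) t by auto
      qed
      then have cont: "isCont (normalized_gram M0) (S t \<omega>)"
        using continuous_on_normalized_gram[of M0] by (simp add: continuous_on_eq_continuous_at open_Compl)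
      have "((\<lambda>s. S s \<omega>) \<longlongrightarrow> S t \<omega>) (at_right t)" using S_rc elim t space_Q by auto
      from isCont_tendsto_compose[OF cont this]
      show "((\<lambda>s. M s \<omega>) \<longlongrightarrow> M t \<omega>) (at_right t)" unfolding M_eq .
    qed
  qed

  \<comment> \<open>The limit variable and closure of the martingale\<close>
  define Minf where "Minf \<omega> = lim (\<lambda>n. M (real n) \<omega>)" for \<omega>
  \<comment> \<open>The limit along integer times is defined at every point and measurable; where
    the limit over real times exists, the two agree.\<close>
  have Minf_Q: "Minf \<in> borel_measurable Q"
    unfolding Minf_def by (rule borel_measurable_lim_metric) (rule M_Q, simp)
  have conv: "AE \<omega> in Q. ((\<lambda>t. M t \<omega>) \<longlongrightarrow> Minf \<omega>) at_top"
    using Q.bounded_martingale_AE_convergent_euclidean[OF mart M_bnd M_rc]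
  proof eventually_elim
    case (elim \<omega>)
    then obtain l where l: "((\<lambda>t. M t \<omega>) \<longlongrightarrow> l) at_top" by blast
    have "(\<lambda>n. M (real n) \<omega>) \<longlonglongrightarrow> l"
      using filterlim_compose[OF l filterlim_real_sequentially] .
    then have "Minf \<omega> = l" unfolding Minf_def by (rule limI)
    then show ?case using l by simp
  qed
  have conv_seq: "AE \<omega> in Q. (\<lambda>n. M (real n) \<omega>) \<longlonglongrightarrow> Minf \<omega>"
    using conv by eventually_elim (rule filterlim_compose[OF _ filterlim_real_sequentially])
  have Minf_int: "integrable Q Minf"
    by (rule integrable_dominated_convergence[OF Minf_Q M_Q _ conv_seq, where w="\<lambda>_. B"]) (use M_bnd in auto)
  have M_set_lim: "(\<lambda>n. set_lebesgue_integral Q A (M (real n))) \<longlonglongrightarrow> set_lebesgue_integral Q A Minf"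
    if A: "A \<in> sets Q" for A
    unfolding set_lebesgue_integral_def
  proof (rule integral_dominated_convergence[where w="\<lambda>_. B"])
    show "AE \<omega> in Q. (\<lambda>n. indicator A \<omega> *\<^sub>R M (real n) \<omega>) \<longlonglongrightarrow> indicator A \<omega> *\<^sub>R Minf \<omega>"
      using conv_seq by eventually_elim (intro tendsto_intros)
    show "AE \<omega> in Q. norm (indicator A \<omega> *\<^sub>R M (real n) \<omega>) \<le> B" for n
      using M_bnd by (intro AE_I2) (auto simp: indicator_def B_def)
    show "(\<lambda>\<omega>. indicator A \<omega> *\<^sub>R M (real n) \<omega>) \<in> borel_measurable Q" for n
      using A M_Q[of "real n"] by (intro borel_measurable_scaleR borel_measurable_indicator) auto
    show "(\<lambda>\<omega>. indicator A \<omega> *\<^sub>R Minf \<omega>) \<in> borel_measurable Q"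
      using A Minf_Q by (intro borel_measurable_scaleR borel_measurable_indicator)
  qed simp
  \<comment> \<open>For \<open>A\<close> in \<open>F t\<close> the integrals of
    \<open>M (real n)\<close> over \<open>A\<close> are constant once \<open>real n\<close> passes
    \<open>t\<close>, so their limit is that constant.\<close>
  have Minf_set: "set_lebesgue_integral Q A Minf = set_lebesgue_integral Q A (M t)"
    if t: "0 \<le> t" and A: "A \<in> sets (F t)" for t A
  proof (rule LIMSEQ_unique[OF M_set_lim[OF Q.sets_F[OF t A]]])
    have "set_lebesgue_integral Q A (M (real n)) = set_lebesgue_integral Q A (M t)" if "nat \<lceil>t\<rceil> \<le> n" for n
    proof -
      have "t \<le> real n" using that by linarith
      then show ?thesis using mart t A unfolding cmartingale_def by blast
    qed
    then show "(\<lambda>n. set_lebesgue_integral Q A (M (real n))) \<longlonglongrightarrow> set_lebesgue_integral Q A (M t)"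
      by (intro tendsto_eventually eventually_sequentiallyI[of "nat \<lceil>t\<rceil>"])
  qed

  \<comment> \<open>The density formula and its consequences for every state\<close>
  have stable: "Int_stable (\<Union>t\<in>{0..}. sets (F t))"
  proof (rule Int_stableI)
    fix a b assume "a \<in> (\<Union>t\<in>{0..}. sets (F t))" "b \<in> (\<Union>t\<in>{0..}. sets (F t))"
    then obtain s t where st: "0 \<le> s" "a \<in> sets (F s)" "0 \<le> t" "b \<in> sets (F t)" by auto
    then have "a \<in> sets (F (max s t))" "b \<in> sets (F (max s t))"
      using F2[of s "max s t"] F2[of t "max s t"] by auto
    then show "a \<inter> b \<in> (\<Union>t\<in>{0..}. sets (F t))" using st by (intro UN_I[of "max s t"]) auto
  qed
  have formula: "complex_of_real (measure (Prho \<rho>) A) = set_lebesgue_integral Q A (\<lambda>\<omega>. h \<rho> (Minf \<omega>))"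
    if \<rho>: "density_matrix \<rho>" and A: "A \<in> sets P" for \<rho> A
  proof (rule measure_eq_set_integral_sigma_sets[OF _ _ _ stable])
    show "finite_measure (Prho \<rho>)" using prob[OF \<rho>] by (rule prob_space.finite_measure)
    show "sets (Prho \<rho>) = sets Q" using sets_rho[OF \<rho>] sets_Q by simp
    show "sets Q = sigma_sets (space Q) (\<Union>t\<in>{0..}. sets (F t))" using F3 sets_Q space_Q by simp
    show "space Q \<in> (\<Union>t\<in>{0..}. sets (F t))"
      using sets.top[of "F 0"] Q.space_F[of 0] by auto
    show "integrable Q (\<lambda>\<omega>. h \<rho> (Minf \<omega>))" by (rule integrable_bounded_linear[OF h_lin Minf_int])
    show "A \<in> sets Q" using A sets_Q by simp
    fix A assume "A \<in> (\<Union>t\<in>{0..}. sets (F t))"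
    then obtain t where t: "0 \<le> t" "A \<in> sets (F t)" by auto
    have AQ: "A \<in> sets Q" by (rule Q.sets_F[OF t])
    show "complex_of_real (measure (Prho \<rho>) A) = set_lebesgue_integral Q A (\<lambda>\<omega>. h \<rho> (Minf \<omega>))"
      unfolding h_set[OF Minf_int AQ, symmetric] Minf_set[OF t] h_set[OF M_int[OF t(1)] AQ]
      using rep[OF \<rho> t] by simp
  qed
  have conv_rho: "AE \<omega> in Prho \<rho>. ((\<lambda>t. M t \<omega>) \<longlongrightarrow> Minf \<omega>) at_top" if \<rho>: "density_matrix \<rho>" for \<rho>
  proof -
    \<comment> \<open>The set of nonconvergence is covered by a \<open>Q\<close>-null event
      \<open>N\<close>; by \<open>formula\<close> its \<open>Prho \<rho>\<close>-measure is an
      integral over a null set and thus zero.\<close>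
    obtain N where N: "{\<omega>\<in>space Q. \<not> ((\<lambda>t. M t \<omega>) \<longlongrightarrow> Minf \<omega>) at_top} \<subseteq> N"
      "N \<in> null_sets Q"
      using conv unfolding eventually_ae_filter by auto
    have "complex_of_real (measure (Prho \<rho>) N) = set_lebesgue_integral Q N (\<lambda>\<omega>. h \<rho> (Minf \<omega>))"
      using N sets_Q by (intro formula[OF \<rho>]) auto
    also have "\<dots> = 0"
      unfolding set_lebesgue_integral_def
      by (rule integral_eq_zero_AE) (use AE_not_in[OF N(2)] in \<open>eventually_elim, simp\<close>)
    finally have "measure (Prho \<rho>) N = 0" by simp
    then have "N \<in> null_sets (Prho \<rho>)"
      using N sets_Q sets_rho[OF \<rho>] prob_space.finite_measure[OF prob[OF \<rho>]]
      by (intro null_setsI) (auto simp: finite_measure.emeasure_eq_measure)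
    then show ?thesis using N(1) space_Q space_rho[OF \<rho>] by (intro AE_I'[of N]) auto
  qed
  \<comment> \<open>The bound on \<open>M\<close> holds at every point, hence under each
    \<open>Prho \<rho>\<close>; the chaotic measure is the instance \<open>ch\<close>.\<close>
  have L1: "((\<lambda>t. \<integral>\<^sup>+\<omega>. ennreal (norm (M t \<omega> - Minf \<omega>)) \<partial>Prho \<rho>) \<longlongrightarrow> 0) at_top"
    if \<rho>: "density_matrix \<rho>" for \<rho>
  proof (rule finite_measure.bounded_convergence_L1_at_top[OF _ _ _ M_bnd conv_rho[OF \<rho>]])
    have cong: "borel_measurable (Prho \<rho>) = (borel_measurable Q :: ('a \<Rightarrow> complex^'k^'k) set)"
      using sets_Q sets_rho[OF \<rho>] by (intro measurable_cong_sets) auto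
    show "finite_measure (Prho \<rho>)" using prob[OF \<rho>] by (rule prob_space.finite_measure)
    show "M t \<in> borel_measurable (Prho \<rho>)" if "0 \<le> t" for t unfolding cong by (rule M_Q[OF that])
    show "Minf \<in> borel_measurable (Prho \<rho>)" unfolding cong by (rule Minf_Q)
  qed
  have Minf_P: "Minf \<in> borel_measurable P"
    using Minf_Q measurable_cong_sets[OF sets_Q refl] by blast
  show ?thesis
    unfolding Let_def ch_def[symmetric] Q_def[symmetric] M_def[symmetric]
    using mart M_bnd Minf_P conv L1[OF ch, folded Q_def] formula[unfolded h_def] conv_rho L1 by blast
qed

end
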